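(* Let $n\ge 2$. The groups $FWB_n$ and $FVB_n/\Gamma_2(FVP_n)$ are isomorphic to $VT_n/\Gamma_2(PVT_n)$.
   Context: $\Gamma_2(H)=[H,H]$. The virtual twin group $VT_n$ is the group with generators $\sigma_i,\rho_i$ ($1\le i\le n-1$) and relations: $\sigma_i^2=1$, $\rho_i^2=1$ for $1\le i\le n-1$; $\sigma_i\sigma_j=\sigma_j\sigma_i$, $\rho_i\rho_j=\rho_j\rho_i$, $\rho_i\sigma_j=\sigma_j\rho_i$ for $|i-j|\ge 2$; $\rho_i\rho_{i+1}\rho_i=\rho_{i+1}\rho_i\rho_{i+1}$ and $\rho_i\rho_{i+1}\sigma_i=\sigma_{i+1}\rho_i\rho_{i+1}$ for $1\le i\le n-2$. The flat virtual braid group $FVB_n$ is the quotient of $VT_n$ by the relations $\sigma_i\sigma_{i+1}\sigma_i=\sigma_{i+1}\sigma_i\sigma_{i+1}$, $1\le i\le n-2$. The flat welded braid group $FWB_n$ is the quotient of $FVB_n$ by the relations $\rho_i\sigma_{i+1}\sigma_i=\sigma_{i+1}\sigma_i\rho_{i+1}$, $1\le i\le n-2$. The pure subgroups $PVT_n$ and $FVP_n$ are the kernels of the homomorphisms $VT_n\to S_n$ and $FVB_n\to S_n$, respectively, given by $\sigma_i,\rho_i\mapsto(i,i+1)$. *)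

theory Defs
  imports "HOL-Algebra.Sym_Groups"
begin

section \<open>Groups given by generators and relations\<close>

text \<open>
  A letter \<open>(x, True)\<close> of a word stands for the generator \<open>x\<close>, and \<open>(x, False)\<close> for its formal
  inverse.
\<close>

type_synonym 'a word = "('a \<times> bool) list"

definition words :: "'a set \<Rightarrow> 'a word set"
  where "words X = lists (X \<times> UNIV)"

text \<open>
  The least congruence on the words over \<open>X\<close> that makes the two signs of a letter mutually inverse
  and identifies \<open>u\<close> with \<open>v\<close> for every relation \<open>u = v\<close>, given as a pair \<open>(u, v) \<in> R\<close>.
\<close>

inductive_set word_cong :: "'a set \<Rightarrow> ('a word \<times> 'a word) set \<Rightarrow> ('a word \<times> 'a word) set"
  for X R where
  refl: "w \<in> words X \<Longrightarrow> (w, w) \<in> word_cong X R"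
| sym: "(u, v) \<in> word_cong X R \<Longrightarrow> (v, u) \<in> word_cong X R"
| trans: "(u, v) \<in> word_cong X R \<Longrightarrow> (v, w) \<in> word_cong X R \<Longrightarrow> (u, w) \<in> word_cong X R"
| append: "(u, u') \<in> word_cong X R \<Longrightarrow> (v, v') \<in> word_cong X R \<Longrightarrow> (u @ v, u' @ v') \<in> word_cong X R"
| cancel: "x \<in> X \<Longrightarrow> ([(x, b), (x, \<not> b)], []) \<in> word_cong X R"
| rel: "(u, v) \<in> R \<Longrightarrow> u \<in> words X \<Longrightarrow> v \<in> words X \<Longrightarrow> (u, v) \<in> word_cong X R"

definition presented_group :: "'a set \<Rightarrow> ('a word \<times> 'a word) set \<Rightarrow> 'a word set monoid"
  where "presented_group X R =
    \<lparr>carrier = words X // word_cong X R,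
     mult = (\<lambda>A B. \<Union>a\<in>A. \<Union>b\<in>B. word_cong X R `` {a @ b}),
     one = word_cong X R `` {[]}\<rparr>"

text \<open>The value of a word in \<open>G\<close> when the letter \<open>x\<close> is sent to \<open>f x\<close>.\<close>

definition word_value :: "('b, 'm) monoid_scheme \<Rightarrow> ('a \<Rightarrow> 'b) \<Rightarrow> 'a word \<Rightarrow> 'b"
  where "word_value G f w =
    foldr (\<lambda>(x, b) y. (if b then f x else inv\<^bsub>G\<^esub> (f x)) \<otimes>\<^bsub>G\<^esub> y) w \<one>\<^bsub>G\<^esub>"

text \<open>
  The homomorphism out of a presented group given by \<open>x \<mapsto> f x\<close> on generators.  It is meaningful when
  \<open>f\<close> respects the relations: then all words in a class \<open>C\<close> have the same value (see
  \<open>word_value_cong\<close> and \<open>induced_hom_in_hom\<close> below).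
\<close>

definition induced_hom :: "('b, 'm) monoid_scheme \<Rightarrow> ('a \<Rightarrow> 'b) \<Rightarrow> 'a word set \<Rightarrow> 'b"
  where "induced_hom G f C = the_elem (word_value G f ` C)"


section \<open>Virtual twin groups, flat virtual and flat welded braid groups\<close>

datatype gen = Sigma nat | Rho nat

abbreviation \<sigma> :: "nat \<Rightarrow> gen \<times> bool" where "\<sigma> i \<equiv> (Sigma i, True)"
abbreviation \<rho> :: "nat \<Rightarrow> gen \<times> bool" where "\<rho> i \<equiv> (Rho i, True)"

definition gens :: "nat \<Rightarrow> gen set"
  where "gens n = {Sigma i | i. 1 \<le> i \<and> i < n} \<union> {Rho i | i. 1 \<le> i \<and> i < n}"

text \<open>
  In the far commutativity relations, \<open>i + 2 \<le> j \<or> j + 2 \<le> i\<close> expresses \<open>\<bar>i - j\<bar> \<ge> 2\<close> without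
  truncated subtraction; likewise \<open>i < n\<close> and \<open>i + 1 < n\<close> express \<open>i \<le> n - 1\<close> and \<open>i \<le> n - 2\<close>.
\<close>

definition VT_rels :: "nat \<Rightarrow> (gen word \<times> gen word) set"
  where "VT_rels n =
      {([\<sigma> i, \<sigma> i], []) | i. 1 \<le> i \<and> i < n}
    \<union> {([\<rho> i, \<rho> i], []) | i. 1 \<le> i \<and> i < n}
    \<union> {([\<sigma> i, \<sigma> j], [\<sigma> j, \<sigma> i]) | i j.
        1 \<le> i \<and> i < n \<and> 1 \<le> j \<and> j < n \<and> (i + 2 \<le> j \<or> j + 2 \<le> i)}
    \<union> {([\<rho> i, \<rho> j], [\<rho> j, \<rho> i]) | i j.
        1 \<le> i \<and> i < n \<and> 1 \<le> j \<and> j < n \<and> (i + 2 \<le> j \<or> j + 2 \<le> i)}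
    \<union> {([\<rho> i, \<sigma> j], [\<sigma> j, \<rho> i]) | i j.
        1 \<le> i \<and> i < n \<and> 1 \<le> j \<and> j < n \<and> (i + 2 \<le> j \<or> j + 2 \<le> i)}
    \<union> {([\<rho> i, \<rho> (i + 1), \<rho> i], [\<rho> (i + 1), \<rho> i, \<rho> (i + 1)]) | i. 1 \<le> i \<and> i + 1 < n}
    \<union> {([\<rho> i, \<rho> (i + 1), \<sigma> i], [\<sigma> (i + 1), \<rho> i, \<rho> (i + 1)]) | i. 1 \<le> i \<and> i + 1 < n}"

definition FVB_rels :: "nat \<Rightarrow> (gen word \<times> gen word) set"
  where "FVB_rels n = VT_rels n
    \<union> {([\<sigma> i, \<sigma> (i + 1), \<sigma> i], [\<sigma> (i + 1), \<sigma> i, \<sigma> (i + 1)]) | i. 1 \<le> i \<and> i + 1 < n}"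

definition FWB_rels :: "nat \<Rightarrow> (gen word \<times> gen word) set"
  where "FWB_rels n = FVB_rels n
    \<union> {([\<rho> i, \<sigma> (i + 1), \<sigma> i], [\<sigma> (i + 1), \<sigma> i, \<rho> (i + 1)]) | i. 1 \<le> i \<and> i + 1 < n}"

definition VT :: "nat \<Rightarrow> gen word set monoid"
  where "VT n = presented_group (gens n) (VT_rels n)"

definition FVB :: "nat \<Rightarrow> gen word set monoid"
  where "FVB n = presented_group (gens n) (FVB_rels n)"

definition FWB :: "nat \<Rightarrow> gen word set monoid"
  where "FWB n = presented_group (gens n) (FWB_rels n)"

primrec gen_perm :: "gen \<Rightarrow> nat \<Rightarrow> nat" where
  "gen_perm (Sigma i) = transpose i (i + 1)"
| "gen_perm (Rho i) = transpose i (i + 1)"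

definition perm_hom :: "nat \<Rightarrow> gen word set \<Rightarrow> nat \<Rightarrow> nat"
  where "perm_hom n = induced_hom (sym_group n) gen_perm"

definition PVT :: "nat \<Rightarrow> gen word set set"
  where "PVT n = kernel (VT n) (sym_group n) (perm_hom n)"

definition FVP :: "nat \<Rightarrow> gen word set set"
  where "FVP n = kernel (FVB n) (sym_group n) (perm_hom n)"


section \<open>Presented groups are groups\<close>

lemma words_append [simp]: "u @ v \<in> words X \<longleftrightarrow> u \<in> words X \<and> v \<in> words X"
  by (auto simp: words_def)

lemma words_Nil [simp]: "[] \<in> words X"
  by (auto simp: words_def)

lemma words_Cons [simp]: "(x, b) # w \<in> words X \<longleftrightarrow> x \<in> X \<and> w \<in> words X"
  by (auto simp: words_def)

lemma word_cong_words:
  assumes "(u, v) \<in> word_cong X R"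
  shows "u \<in> words X" "v \<in> words X"
  using assms by (induction rule: word_cong.induct) auto

lemma equiv_word_cong: "equiv (words X) (word_cong X R)"
proof (rule equivI)
  show "word_cong X R \<subseteq> words X \<times> words X"
    by (auto dest: word_cong_words)
  show "refl_on (words X) (word_cong X R)"
    by (intro refl_onI word_cong.refl)
  show "sym (word_cong X R)"
    by (rule symI) (rule word_cong.sym)
  show "trans (word_cong X R)"
    by (rule transI) (rule word_cong.trans)
qed

lemma class_in_carrier:
  "w \<in> words X \<Longrightarrow> word_cong X R `` {w} \<in> carrier (presented_group X R)"
  by (simp add: presented_group_def quotientI)

lemma presented_group_cases:
  assumes "C \<in> carrier (presented_group X R)"
  obtains w where "w \<in> words X" "C = word_cong X R `` {w}"
  using assms by (auto simp: presented_group_def elim: quotientE)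

lemma class_eq_iff:
  "u \<in> words X \<Longrightarrow> v \<in> words X \<Longrightarrow>
    word_cong X R `` {u} = word_cong X R `` {v} \<longleftrightarrow> (u, v) \<in> word_cong X R"
  by (rule eq_equiv_class_iff[OF equiv_word_cong])

lemma mult_class:
  assumes "u \<in> words X" "v \<in> words X"
  shows "word_cong X R `` {u} \<otimes>\<^bsub>presented_group X R\<^esub> word_cong X R `` {v} = word_cong X R `` {u @ v}"
proof -
  have "congruent2 (word_cong X R) (word_cong X R) (\<lambda>a b. word_cong X R `` {a @ b})"
    by (rule congruent2I') (rule equiv_class_eq[OF equiv_word_cong], rule word_cong.append)
  from UN_equiv_class2[OF equiv_word_cong equiv_word_cong this assms]
  show ?thesis by (simp add: presented_group_def)
qed

lemma one_class: "\<one>\<^bsub>presented_group X R\<^esub> = word_cong X R `` {[]}"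
  by (simp add: presented_group_def)

lemma word_cong_left_inverse:
  "w \<in> words X \<Longrightarrow> \<exists>v\<in>words X. (v @ w, []) \<in> word_cong X R"
proof (induction w)
  case Nil
  then show ?case by (auto intro!: bexI[of _ "[]"] word_cong.refl)
next
  case (Cons l w)
  obtain x b where l: "l = (x, b)" by force
  with Cons obtain v where v: "v \<in> words X" "(v @ w, []) \<in> word_cong X R" by auto
  have x: "x \<in> X" "w \<in> words X" using Cons.prems l by auto
  have "([(x, \<not> b), (x, b)], []) \<in> word_cong X R"
    using word_cong.cancel[OF x(1), of "\<not> b"] by simp
  then have "([(x, \<not> b), (x, b)] @ w, [] @ w) \<in> word_cong X R"
    using x by (intro word_cong.append word_cong.refl)
  then have "(v @ [(x, \<not> b), (x, b)] @ w, v @ [] @ w) \<in> word_cong X R"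
    using v x by (intro word_cong.append[OF word_cong.refl]) auto
  then have "((v @ [(x, \<not> b)]) @ l # w, []) \<in> word_cong X R"
    using v l by (auto intro: word_cong.trans)
  with v x show ?case by (intro bexI[of _ "v @ [(x, \<not> b)]"]) auto
qed

lemma group_presented_group: "group (presented_group X R)"
proof (rule groupI)
  show "\<one>\<^bsub>presented_group X R\<^esub> \<in> carrier (presented_group X R)"
    by (simp add: one_class class_in_carrier)
next
  fix A assume "A \<in> carrier (presented_group X R)"
  then obtain w where w: "w \<in> words X" "A = word_cong X R `` {w}"
    by (rule presented_group_cases)
  then obtain v where v: "v \<in> words X" "(v @ w, []) \<in> word_cong X R"
    using word_cong_left_inverse by blast
  then have "word_cong X R `` {v} \<otimes>\<^bsub>presented_group X R\<^esub> A = \<one>\<^bsub>presented_group X R\<^esub>"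
    using w by (simp add: mult_class one_class class_eq_iff)
  then show "\<exists>B\<in>carrier (presented_group X R).
      B \<otimes>\<^bsub>presented_group X R\<^esub> A = \<one>\<^bsub>presented_group X R\<^esub>"
    using v class_in_carrier by blast
next
  fix A B assume "A \<in> carrier (presented_group X R)" "B \<in> carrier (presented_group X R)"
  then show "A \<otimes>\<^bsub>presented_group X R\<^esub> B \<in> carrier (presented_group X R)"
    by (elim presented_group_cases) (simp add: mult_class class_in_carrier)
next
  fix A B C
  assume "A \<in> carrier (presented_group X R)" "B \<in> carrier (presented_group X R)"
    "C \<in> carrier (presented_group X R)"
  then show "A \<otimes>\<^bsub>presented_group X R\<^esub> B \<otimes>\<^bsub>presented_group X R\<^esub> C =
      A \<otimes>\<^bsub>presented_group X R\<^esub> (B \<otimes>\<^bsub>presented_group X R\<^esub> C)"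
    by (elim presented_group_cases) (simp add: mult_class)
next
  fix A assume "A \<in> carrier (presented_group X R)"
  then show "\<one>\<^bsub>presented_group X R\<^esub> \<otimes>\<^bsub>presented_group X R\<^esub> A = A"
    by (elim presented_group_cases) (simp add: mult_class one_class)
qed


section \<open>The induced homomorphism\<close>

lemma word_value_Nil [simp]: "word_value G f [] = \<one>\<^bsub>G\<^esub>"
  by (simp add: word_value_def)

lemma word_value_Cons [simp]:
  "word_value G f ((x, b) # w) = (if b then f x else inv\<^bsub>G\<^esub> (f x)) \<otimes>\<^bsub>G\<^esub> word_value G f w"
  by (simp add: word_value_def)

context
  fixes G (structure) and f :: "'a \<Rightarrow> 'b" and X :: "'a set"
  assumes G: "group G" and f: "f \<in> X \<rightarrow> carrier G"
begin

interpretation group G by (rule G)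

lemma word_value_closed: "w \<in> words X \<Longrightarrow> word_value G f w \<in> carrier G"
  using f by (induction w) (auto simp: Pi_iff)

lemma word_value_append:
  "u \<in> words X \<Longrightarrow> v \<in> words X \<Longrightarrow> word_value G f (u @ v) = word_value G f u \<otimes> word_value G f v"
  using f by (induction u) (auto simp: Pi_iff word_value_closed m_assoc)

lemma word_value_cong:
  assumes "\<And>u v. (u, v) \<in> R \<Longrightarrow> u \<in> words X \<Longrightarrow> v \<in> words X \<Longrightarrow> word_value G f u = word_value G f v"
    and "(u, v) \<in> word_cong X R"
  shows "word_value G f u = word_value G f v"
  using assms(2)
proof (induction rule: word_cong.induct)
  case (append u u' v v')
  then show ?case by (simp add: word_value_append word_cong_words[of _ _ X R])
next
  case (cancel x b)
  then have "f x \<in> carrier G" using f by auto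
  then show ?case by (cases b) auto
qed (use assms(1) in auto)

lemma induced_hom_class:
  assumes "\<And>u v. (u, v) \<in> R \<Longrightarrow> u \<in> words X \<Longrightarrow> v \<in> words X \<Longrightarrow> word_value G f u = word_value G f v"
    and "w \<in> words X"
  shows "induced_hom G f (word_cong X R `` {w}) = word_value G f w"
proof -
  have "word_value G f ` (word_cong X R `` {w}) = {word_value G f w}"
  proof (intro equalityI subsetI)
    fix y assume "y \<in> word_value G f ` (word_cong X R `` {w})"
    then obtain v where v: "(w, v) \<in> word_cong X R" "y = word_value G f v" by blast
    have "word_value G f w = word_value G f v"
      by (rule word_value_cong[OF _ v(1)]) (rule assms(1))
    with v show "y \<in> {word_value G f w}" by simp
  next
    fix y assume "y \<in> {word_value G f w}"
    then show "y \<in> word_value G f ` (word_cong X R `` {w})"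
      using word_cong.refl[OF assms(2), of R] by auto
  qed
  then show ?thesis by (simp add: induced_hom_def)
qed

lemma induced_hom_in_hom:
  assumes "\<And>u v. (u, v) \<in> R \<Longrightarrow> u \<in> words X \<Longrightarrow> v \<in> words X \<Longrightarrow> word_value G f u = word_value G f v"
  shows "induced_hom G f \<in> hom (presented_group X R) G"
  by (rule homI)
     (auto elim!: presented_group_cases
           simp: induced_hom_class[OF assms] word_value_closed word_value_append mult_class)

end


section \<open>The homomorphisms onto the symmetric group\<close>

lemma gen_perm_closed: "gen_perm \<in> gens n \<rightarrow> carrier (sym_group n)"
  by (auto simp: gens_def sym_group_carrier intro!: permutes_swap_id)

lemma transpose_far:
  fixes i j :: nat
  assumes "i + 2 \<le> j \<or> j + 2 \<le> i"
  shows "transpose i (Suc i) \<circ> transpose j (Suc j) = transpose j (Suc j) \<circ> transpose i (Suc i)"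
proof (rule ext)
  fix k
  have d: "i \<noteq> j" "i \<noteq> Suc j" "Suc i \<noteq> j" using assms by auto
  consider "k = i" | "k = Suc i" | "k = j" | "k = Suc j"
    | "k \<noteq> i" "k \<noteq> Suc i" "k \<noteq> j" "k \<noteq> Suc j" by blast
  then show "(transpose i (Suc i) \<circ> transpose j (Suc j)) k =
      (transpose j (Suc j) \<circ> transpose i (Suc i)) k"
    by cases (use d in \<open>simp_all add: transpose_apply_other\<close>)
qed

lemma transpose_braid:
  fixes i :: nat
  shows "transpose i (Suc i) \<circ> (transpose (Suc i) (Suc (Suc i)) \<circ> transpose i (Suc i)) =
    transpose (Suc i) (Suc (Suc i)) \<circ> (transpose i (Suc i) \<circ> transpose (Suc i) (Suc (Suc i)))"
proof (rule ext)
  fix k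
  consider "k = i" | "k = Suc i" | "k = Suc (Suc i)"
    | "k \<noteq> i" "k \<noteq> Suc i" "k \<noteq> Suc (Suc i)" by blast
  then show "(transpose i (Suc i) \<circ> (transpose (Suc i) (Suc (Suc i)) \<circ> transpose i (Suc i))) k =
      (transpose (Suc i) (Suc (Suc i)) \<circ> (transpose i (Suc i) \<circ> transpose (Suc i) (Suc (Suc i)))) k"
    by cases (simp_all add: transpose_apply_other)
qed

lemma word_value_FVB_rels:
  assumes "(u, v) \<in> FVB_rels n"
  shows "word_value (sym_group n) gen_perm u = word_value (sym_group n) gen_perm v"
  using assms unfolding FVB_rels_def VT_rels_def
  by (auto simp: sym_group_mult sym_group_one transpose_far transpose_braid)

lemma group_VT: "group (VT n)"
  and group_FVB: "group (FVB n)"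
  and group_FWB: "group (FWB n)"
  by (simp_all add: VT_def FVB_def FWB_def group_presented_group)

lemma perm_hom_VT: "perm_hom n \<in> hom (VT n) (sym_group n)"
  unfolding perm_hom_def VT_def
  by (rule induced_hom_in_hom[OF sym_group_is_group gen_perm_closed])
     (auto intro: word_value_FVB_rels simp: FVB_rels_def)

lemma perm_hom_FVB: "perm_hom n \<in> hom (FVB n) (sym_group n)"
  unfolding perm_hom_def FVB_def
  by (rule induced_hom_in_hom[OF sym_group_is_group gen_perm_closed])
     (auto intro: word_value_FVB_rels)

lemma perm_hom_VT_gen:
  assumes "x \<in> gens n"
  shows "perm_hom n (word_cong (gens n) (VT_rels n) `` {[(x, True)]}) = gen_perm x"
  unfolding perm_hom_def using assms
  by (subst induced_hom_class[OF sym_group_is_group gen_perm_closed])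
     (auto intro: word_value_FVB_rels simp: FVB_rels_def sym_group_mult sym_group_one)

lemma perm_hom_FVB_gen:
  assumes "x \<in> gens n"
  shows "perm_hom n (word_cong (gens n) (FVB_rels n) `` {[(x, True)]}) = gen_perm x"
  unfolding perm_hom_def using assms
  by (subst induced_hom_class[OF sym_group_is_group gen_perm_closed])
     (auto intro: word_value_FVB_rels simp: sym_group_mult sym_group_one)

end

theory Submission
  imports Defs
begin

text \<open>
  Put \<open>a i = \<sigma> i \<rho> i\<close>, an element of the pure group.  The conjugates of these elements under the
  subgroup generated by the \<open>\<rho> i\<close> form a family \<open>lam k l\<close>, indexed by ordered pairs of distinct points
  of \<open>{1..n}\<close>, on which that subgroup acts by permuting the indices; moreover \<open>lam l k\<close> is the inverse of \<open>lam k l\<close> and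
  \<open>lam i (i + 1) = a i\<close>.  With \<open>b i = \<rho> i a (i + 1) \<rho> i\<close> for \<open>lam i (i + 2)\<close>,
  rewriting both sides of the two additional relations in terms of this family
  (\<open>sss_eq\<close>, \<open>sss_eq'\<close>, \<open>rss_eq\<close>, \<open>ssr_eq\<close>) shows that they say, with \<open>j = i + 1\<close> and \<open>k = i + 2\<close>,

    \<^item> \<open>lam i j \<cdot> lam i k \<cdot> lam j k = lam j k \<cdot> lam i k \<cdot> lam i j\<close> for the braid relation of the \<open>\<sigma> i\<close>,

    \<^item> \<open>lam i k \<cdot> lam j k = lam j k \<cdot> lam i k\<close> for the welded relation.

  Both are consequences of commutativity of the pure group, so both hold in \<open>VT\<close> modulo the derived
  subgroup of its pure subgroup (\<open>FWB_rels_mod_derived_PVT\<close>).  It follows formally that for every set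
  of relations between those of \<open>VT\<close> and those of \<open>FWB\<close> the quotient by the derived subgroup of the
  pure subgroup is the same group (\<open>presented_group_Mod_derived_iso\<close>,
  \<open>presented_group_Mod_derived_kernel_iso\<close>).  The claim about \<open>FVB\<close> is an instance.

  For \<open>FWB\<close> itself, the pure subgroup must be shown to be abelian, so that its derived subgroup is
  trivial.  By symmetry the welded relation makes any two elements \<open>lam k l\<close> that share an index
  commute, and those with disjoint indices commute by far commutativity.  The group is the product of
  the abelian subgroup generated by the \<open>lam k l\<close> and of the subgroup generated by the \<open>\<rho> i\<close>.  The latter
  maps injectively to the symmetric group, by the normal form argument for its Coxeter presentation,
  so the kernel of the map to the symmetric group is exactly the abelian factor
  (\<open>kernel_commutative\<close>).
\<close>


section \<open>Subgroups generated by a set\<close>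

lemma (in group) generate_commute:
  assumes "S \<subseteq> carrier G" "g \<in> generate G S" "x \<in> carrier G"
    and "\<And>y. y \<in> S \<Longrightarrow> y \<otimes> x = x \<otimes> y"
  shows "g \<otimes> x = x \<otimes> g"
  using assms(2)
proof (induction rule: generate.induct)
  case (inv y)
  then have "y \<in> carrier G" "y \<otimes> x = x \<otimes> y" using assms by auto
  then show ?case using assms(3) by (metis inv_closed inv_solve_left inv_solve_right m_assoc m_closed)
next
  case (eng g h)
  then have "g \<in> carrier G" "h \<in> carrier G"
    using generate_in_carrier[OF assms(1)] by auto
  with eng assms(3) show ?case by (metis m_assoc)
qed (use assms in auto)

text \<open>
  For involutions every element of the generated subgroup is a product of generators, without inverses,
  and so it can be built up by multiplications on the left.
\<close>

lemma (in group) generate_involutions_induct: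
  assumes "g \<in> generate G S" "S \<subseteq> carrier G" "D \<subseteq> carrier G" "\<one> \<in> D"
    and "\<And>y. y \<in> S \<Longrightarrow> inv y = y"
    and "\<And>y x. y \<in> S \<Longrightarrow> x \<in> D \<Longrightarrow> y \<otimes> x \<in> D"
  shows "g \<in> D"
proof -
  have "\<forall>x\<in>D. g \<otimes> x \<in> D"
    using assms(1)
  proof (induction rule: generate.induct)
    case (eng g h)
    then have "g \<in> carrier G" "h \<in> carrier G"
      using generate_in_carrier[OF assms(2)] by auto
    with eng assms(3) show ?case by (auto simp: m_assoc subset_iff)
  qed (use assms in auto)
  then have "g \<otimes> \<one> \<in> D" using assms(4) by blast
  then show ?thesis using generate_in_carrier[OF assms(2,1)] by simp
qed


section \<open>Groups satisfying the Coxeter relations of the symmetric group\<close>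

locale symmetric_generators = group G for G (structure) +
  fixes n :: nat and r :: "nat \<Rightarrow> 'a"
  assumes r_closed: "1 \<le> i \<Longrightarrow> i < n \<Longrightarrow> r i \<in> carrier G"
    and r_square: "1 \<le> i \<Longrightarrow> i < n \<Longrightarrow> r i \<otimes> r i = \<one>"
    and r_far: "1 \<le> i \<Longrightarrow> i + 2 \<le> j \<Longrightarrow> j < n \<Longrightarrow> r i \<otimes> r j = r j \<otimes> r i"
    and r_braid: "1 \<le> i \<Longrightarrow> Suc i < n \<Longrightarrow> r i \<otimes> r (Suc i) \<otimes> r i = r (Suc i) \<otimes> r i \<otimes> r (Suc i)"
begin

lemma inv_r: "1 \<le> i \<Longrightarrow> i < n \<Longrightarrow> inv (r i) = r i"
  by (simp add: inv_equality r_closed r_square)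

lemma r_cancel: "1 \<le> i \<Longrightarrow> i < n \<Longrightarrow> x \<in> carrier G \<Longrightarrow> r i \<otimes> (r i \<otimes> x) = x"
  by (simp add: m_assoc[symmetric] r_closed r_square)

text \<open>
  The parabolic subgroup that stands for the permutations of \<open>{m..n}\<close>.  The tails form a chain from
  \<open>tail 1\<close>, generated by all \<open>r i\<close>, down to the trivial group.
\<close>

definition tail :: "nat \<Rightarrow> 'a set"
  where "tail m = generate G (r ` {m..<n})"

text \<open>
  The product \<open>r (k - 1) \<otimes> \<dots> \<otimes> r m\<close>, which corresponds to a cycle that takes \<open>m\<close> to \<open>k\<close>.  For
  \<open>m \<le> k \<le> n\<close> these are representatives of the left cosets of \<open>tail (m + 1)\<close> in \<open>tail m\<close>.
\<close>

primrec descent :: "nat \<Rightarrow> nat \<Rightarrow> 'a" where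
  "descent m 0 = \<one>"
| "descent m (Suc k) = (if k < m then \<one> else r k \<otimes> descent m k)"

lemma descent_trivial [simp]: "k \<le> m \<Longrightarrow> descent m k = \<one>"
  by (cases k) auto

lemma descent_closed: "1 \<le> m \<Longrightarrow> k \<le> n \<Longrightarrow> descent m k \<in> carrier G"
  by (induction k) (auto simp: r_closed)

lemma tail_subgroup: "1 \<le> m \<Longrightarrow> subgroup (tail m) G"
  unfolding tail_def by (rule generate_is_subgroup) (auto simp: r_closed)

lemma tail_closed: "1 \<le> m \<Longrightarrow> g \<in> tail m \<Longrightarrow> g \<in> carrier G"
  using tail_subgroup subgroup.mem_carrier by metis

lemma tail_mult: "1 \<le> m \<Longrightarrow> g \<in> tail m \<Longrightarrow> h \<in> tail m \<Longrightarrow> g \<otimes> h \<in> tail m"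
  using tail_subgroup subgroup.m_closed by metis

lemma tail_inv: "1 \<le> m \<Longrightarrow> g \<in> tail m \<Longrightarrow> inv g \<in> tail m"
  using tail_subgroup subgroup.m_inv_closed by metis

lemma tail_one: "\<one> \<in> tail m"
  unfolding tail_def by (rule generate.one)

lemma r_in_tail: "m \<le> i \<Longrightarrow> i < n \<Longrightarrow> r i \<in> tail m"
  unfolding tail_def by (rule generate.incl) simp

lemma tail_antimono: "l \<le> m \<Longrightarrow> tail m \<subseteq> tail l"
  unfolding tail_def by (rule mono_generate) auto

lemma tail_trivial: "n \<le> m \<Longrightarrow> tail m = {\<one>}"
  by (simp add: tail_def generate_empty)

lemma descent_in_tail: "1 \<le> m \<Longrightarrow> k \<le> n \<Longrightarrow> descent m k \<in> tail m"
  by (induction k) (auto simp: tail_one r_in_tail tail_mult)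

lemma descent_commute:
  assumes "1 \<le> m" "k < j" "j < n"
  shows "r j \<otimes> descent m k = descent m k \<otimes> r j"
  using assms(2)
proof (induction k)
  case (Suc k)
  show ?case
  proof (cases "k < m")
    case False
    have c: "r j \<in> carrier G" "r k \<in> carrier G" "descent m k \<in> carrier G"
      using False Suc.prems assms by (auto intro!: r_closed descent_closed)
    have "r j \<otimes> r k = r k \<otimes> r j"
      using False Suc.prems assms by (intro r_far[symmetric]) auto
    then have "r j \<otimes> (r k \<otimes> descent m k) = r k \<otimes> (r j \<otimes> descent m k)"
      using c by (metis m_assoc)
    also have "\<dots> = r k \<otimes> descent m k \<otimes> r j"
      using Suc c by (simp add: m_assoc)
    finally show ?thesis using False by simp
  qed (use assms in \<open>simp add: r_closed\<close>)
qed (use assms in \<open>simp add: r_closed\<close>)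

text \<open>
  The generator \<open>r j\<close> moves through the factors with index above \<open>j + 1\<close> by far commutativity, a
  braid relation at \<open>r (j + 1) \<otimes> r j\<close> turns it into \<open>r (j + 1)\<close>, and this commutes with the factors that
  remain.
\<close>

lemma descent_shift:
  assumes "1 \<le> m" "m \<le> j" "Suc j < k" "k \<le> n"
  shows "r j \<otimes> descent m k = descent m k \<otimes> r (Suc j)"
  using assms(3,4)
proof (induction k)
  case (Suc k)
  have c: "r j \<in> carrier G" "r k \<in> carrier G" "descent m k \<in> carrier G" "r (Suc j) \<in> carrier G"
      "descent m j \<in> carrier G"
    using Suc.prems assms by (auto intro!: r_closed descent_closed)
  show ?case
  proof (cases "k = Suc j")
    case True
    have "r j \<otimes> (r (Suc j) \<otimes> (r j \<otimes> descent m j)) = r j \<otimes> r (Suc j) \<otimes> r j \<otimes> descent m j"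
      using c by (simp add: m_assoc)
    also have "\<dots> = r (Suc j) \<otimes> r j \<otimes> (r (Suc j) \<otimes> descent m j)"
      using Suc.prems True assms c by (subst r_braid) (auto simp: m_assoc)
    also have "\<dots> = r (Suc j) \<otimes> (r j \<otimes> descent m j) \<otimes> r (Suc j)"
      using descent_commute[of m j "Suc j"] Suc.prems True assms c by (simp add: m_assoc)
    finally show ?thesis using True assms by simp
  next
    case False
    have "r j \<otimes> r k = r k \<otimes> r j"
      using False Suc.prems assms by (intro r_far) auto
    then have "r j \<otimes> (r k \<otimes> descent m k) = r k \<otimes> (r j \<otimes> descent m k)"
      using c by (metis m_assoc)
    also have "\<dots> = r k \<otimes> descent m k \<otimes> r (Suc j)"
      using Suc False c by (simp add: m_assoc)
    finally show ?thesis using Suc.prems assms by simp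
  qed
qed simp

text \<open>
  This is the normal form of the Coxeter presentation: the set \<open>D\<close> of products of a coset
  representative and an element of \<open>tail (m + 1)\<close> contains the unit and absorbs multiplication by every
  generator \<open>r j\<close> of \<open>tail m\<close> on the left.  Depending on the position of \<open>j\<close> relative to \<open>k\<close>, the
  factor \<open>r j\<close> commutes with the representative and joins the tail, lengthens the representative, cancels
  against its first factor, or passes through it and reaches the tail as \<open>r (j + 1)\<close>.
\<close>

lemma tail_decomposition:
  assumes "1 \<le> m" "m \<le> n" "g \<in> tail m"
  obtains k w where "m \<le> k" "k \<le> n" "w \<in> tail (Suc m)" "g = descent m k \<otimes> w"
proof -
  define D where "D = {descent m k \<otimes> w | k w. m \<le> k \<and> k \<le> n \<and> w \<in> tail (Suc m)}"
  have D_I: "descent m k \<otimes> w \<in> D" if "m \<le> k" "k \<le> n" "w \<in> tail (Suc m)" for k w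
    using that by (auto simp: D_def)
  have tc: "w \<in> carrier G" if "w \<in> tail (Suc m)" for w
    using that by (intro tail_closed[of "Suc m"]) auto
  have D_closed: "x \<in> carrier G" if "x \<in> D" for x
    using that assms tc by (auto simp: D_def descent_closed)
  have step: "r j \<otimes> x \<in> D" if j: "m \<le> j" "j < n" and x: "x \<in> D" for j x
  proof -
    obtain k w where kw: "m \<le> k" "k \<le> n" "w \<in> tail (Suc m)" "x = descent m k \<otimes> w"
      using x by (auto simp: D_def)
    have c: "r j \<in> carrier G" "descent m k \<in> carrier G" "w \<in> carrier G"
      using assms j kw tc by (auto simp: r_closed descent_closed)
    have mv: "r j \<otimes> x = r j \<otimes> descent m k \<otimes> w" using c kw by (simp add: m_assoc)
    consider "k < j" | "j = k" | "Suc j = k" | "Suc j < k" by linarith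
    then show ?thesis
    proof cases
      case 1
      then have "r j \<otimes> x = descent m k \<otimes> (r j \<otimes> w)"
        using mv c assms j by (simp add: descent_commute m_assoc)
      moreover have "r j \<otimes> w \<in> tail (Suc m)" using 1 kw j by (intro tail_mult r_in_tail) auto
      ultimately show ?thesis using D_I kw by simp
    next
      case 2
      then have "r j \<otimes> x = descent m (Suc k) \<otimes> w" using mv kw by simp
      then show ?thesis using D_I[of "Suc k" w] 2 kw j by simp
    next
      case 3
      then have d: "descent m k = r j \<otimes> descent m j" using j by auto
      have "descent m j \<in> carrier G" using assms j by (auto simp: descent_closed)
      then have "r j \<otimes> x = descent m j \<otimes> w" using mv d c assms j by (simp add: r_cancel)
      then show ?thesis using D_I[of j w] j kw by simp
    next
      case 4
      then have "r j \<otimes> x = descent m k \<otimes> (r (Suc j) \<otimes> w)"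
        using mv c assms j kw by (simp add: descent_shift m_assoc r_closed)
      moreover have "r (Suc j) \<otimes> w \<in> tail (Suc m)"
        using 4 kw j by (intro tail_mult r_in_tail) auto
      ultimately show ?thesis using D_I kw by simp
    qed
  qed
  have "g \<in> D"
    using assms(3) unfolding tail_def
  proof (rule generate_involutions_induct)
    show "\<one> \<in> D" using D_I[of m \<one>] assms by (simp add: tail_one)
  qed (use assms step D_closed in \<open>auto simp: inv_r r_closed\<close>)
  then show thesis using that by (auto simp: D_def)
qed

end

text \<open>
  A homomorphism \<open>\<pi>\<close> that sends \<open>r i\<close> to the transposition \<open>(i, i + 1)\<close> restricts to an
  isomorphism from \<open>tail 1\<close> onto the symmetric group.
\<close>

locale symmetric_generators_hom = symmetric_generators +
  fixes \<pi> :: "'a \<Rightarrow> nat \<Rightarrow> nat"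
  assumes \<pi>_hom: "\<pi> \<in> hom G (sym_group n)"
    and \<pi>_r: "1 \<le> i \<Longrightarrow> i < n \<Longrightarrow> \<pi> (r i) = transpose i (Suc i)"
begin

sublocale \<pi>: group_hom G "sym_group n" \<pi>
  by (simp add: group_hom_axioms.intro group_hom_def sym_group_is_group is_group \<pi>_hom)

lemma \<pi>_mult: "g \<in> carrier G \<Longrightarrow> h \<in> carrier G \<Longrightarrow> \<pi> (g \<otimes> h) = \<pi> g \<circ> \<pi> h"
  by (simp add: sym_group_mult)

lemma \<pi>_one: "\<pi> \<one> = id"
  by (simp add: sym_group_one)

declare \<pi>.hom_mult [simp del] \<pi>.hom_one [simp del] \<pi>.hom_inv [simp del]

lemma \<pi>_inv:
  assumes "g \<in> carrier G"
  shows "\<pi> (inv g) \<circ> \<pi> g = id" "\<pi> g \<circ> \<pi> (inv g) = id"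
  using assms by (metis \<pi>_mult \<pi>_one inv_closed l_inv, metis \<pi>_mult \<pi>_one inv_closed r_inv)

lemma \<pi>_permutes: "g \<in> carrier G \<Longrightarrow> \<pi> g permutes {1..n}"
  using \<pi>.hom_closed by (simp add: sym_group_carrier)

lemma \<pi>_tail:
  assumes "1 \<le> m" "g \<in> tail m" "j < m"
  shows "\<pi> g j = j"
  using assms(2) unfolding tail_def
proof (induction rule: generate.induct)
  case (eng g h)
  then have "g \<in> carrier G" "h \<in> carrier G"
    using tail_closed[OF assms(1)] by (auto simp: tail_def)
  with eng show ?case by (simp add: \<pi>_mult)
qed (use assms in \<open>auto simp: \<pi>_one \<pi>_r inv_r\<close>)

lemma \<pi>_descent: "1 \<le> m \<Longrightarrow> m \<le> k \<Longrightarrow> k \<le> n \<Longrightarrow> \<pi> (descent m k) m = k"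
proof (induction k)
  case (Suc k)
  show ?case
  proof (cases "k < m")
    case True
    then have "Suc k = m" using Suc.prems by simp
    then show ?thesis by (simp add: \<pi>_one)
  next
    case False
    then show ?thesis using Suc by (simp add: \<pi>_mult r_closed descent_closed \<pi>_r)
  qed
qed simp

text \<open>
  In the normal form \<open>descent m k \<otimes> w\<close> of an element, the image of \<open>m\<close> under its permutation is \<open>k\<close>, because
  \<open>w\<close> fixes \<open>m\<close>.  An element that fixes \<open>m\<close> therefore has a trivial representative.
\<close>

lemma stabilizer_in_tail:
  assumes "1 \<le> m" "g \<in> tail m" "\<pi> g m = m"
  shows "g \<in> tail (Suc m)"
proof (cases "m \<le> n")
  case True
  with assms obtain k w where kw: "m \<le> k" "k \<le> n" "w \<in> tail (Suc m)" "g = descent m k \<otimes> w"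
    using tail_decomposition by metis
  have w: "w \<in> carrier G" using kw(3) by (intro tail_closed[of "Suc m"]) auto
  have "\<pi> g m = k"
    using kw w assms \<pi>_tail[of "Suc m" w m] by (simp add: \<pi>_mult descent_closed \<pi>_descent)
  with assms(3) kw w show ?thesis by simp
next
  case False
  with assms show ?thesis by (simp add: tail_trivial)
qed

text \<open>
  Used with all points, this gives injectivity of \<open>\<pi>\<close> on \<open>tail 1\<close>; used with \<open>m = 2\<close>, it gives generators
  for the stabilizer of the pair \<open>(1, 2)\<close>, on which \<open>lam\<close> below depends.
\<close>

lemma pointwise_stabilizer:
  assumes "g \<in> tail 1" "\<And>j. 1 \<le> j \<Longrightarrow> j < Suc m \<Longrightarrow> \<pi> g j = j"
  shows "g \<in> tail (Suc m)"
  using assms(2)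
proof (induction m)
  case (Suc m)
  then show ?case by (intro stabilizer_in_tail[of "Suc m"]) auto
qed (use assms(1) in simp)

lemma \<pi>_faithful:
  assumes "g \<in> tail 1" "\<pi> g = id"
  shows "g = \<one>"
proof -
  have "g \<in> tail (Suc n)" using assms by (intro pointwise_stabilizer) auto
  then show ?thesis by (simp add: tail_trivial)
qed

text \<open>
  A permutation that fixes all points below \<open>m\<close> and takes \<open>m\<close> to \<open>k\<close> becomes one that fixes \<open>m\<close> as well
  when it is composed with the inverse of the permutation of \<open>descent m k\<close>.
\<close>

lemma \<pi>_onto:
  assumes "p permutes {1..n}"
  obtains g where "g \<in> tail 1" "\<pi> g = p"
proof -
  have "\<exists>g\<in>tail 1. \<pi> g = p" if "m \<le> Suc n" "1 \<le> m" "p permutes {1..n}" "\<And>j. j < m \<Longrightarrow> p j = j" for m p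
    using that
  proof (induction m arbitrary: p rule: inc_induct)
    case base
    have "p j = j" for j
      using base by (cases "j < Suc n") (auto simp: permutes_def)
    then have "p = id" by auto
    then show ?case using tail_one[of 1] \<pi>_one by blast
  next
    case (step m)
    have inj: "inj p" using step.prems by (simp add: permutes_inj)
    have k: "m \<le> p m"
    proof (rule ccontr)
      assume "\<not> m \<le> p m"
      then have "p (p m) = p m" using step.prems by simp
      then have "p m = m" using inj by (simp add: inj_eq)
      with \<open>\<not> m \<le> p m\<close> show False by simp
    qed
    have kn: "p m \<le> n"
      using permutes_in_image[OF step.prems(2), of m] step.prems step.hyps by simp
    define d where "d = descent m (p m)"
    have d: "d \<in> tail m" "d \<in> carrier G" "\<pi> d m = p m"
      using step.prems k kn by (auto simp: d_def descent_in_tail descent_closed \<pi>_descent)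
    \<comment> \<open>\<open>q\<close> fixes one point more than \<open>p\<close>, and \<open>p = \<pi> d \<circ> q\<close>.\<close>
    define q where "q = \<pi> (inv d) \<circ> p"
    have dd: "\<pi> d \<circ> \<pi> (inv d) = id" "\<pi> (inv d) \<circ> \<pi> d = id"
      using d by (simp_all add: \<pi>_inv)
    have "q m = m" using dd(2) d(3) by (metis comp_apply id_apply q_def)
    moreover have "q j = j" if "j < m" for j
      using that step.prems d tail_inv[of m d] \<pi>_tail[of m "inv d"] by (simp add: q_def)
    moreover have "q permutes {1..n}"
      unfolding q_def using step.prems d by (intro permutes_compose \<pi>_permutes) auto
    ultimately obtain h where h: "h \<in> tail 1" "\<pi> h = q"
      using step.IH[of q] step.prems by (metis less_Suc_eq le_SucI)
    have "d \<in> tail 1" using d tail_antimono[of 1 m] step.prems by auto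
    then have "d \<otimes> h \<in> tail 1" using h by (simp add: tail_mult)
    moreover have "\<pi> (d \<otimes> h) = p"
      using h d dd(1) tail_closed[of 1 h] by (simp add: \<pi>_mult q_def comp_assoc[symmetric])
    ultimately show ?case by blast
  qed
  from this[of 1 p] assms show thesis using that by (auto simp: permutes_def)
qed

end


section \<open>Permutations with prescribed values\<close>

text \<open>
  The value at a further position is corrected by a transposition, which does not disturb the values
  prescribed before.
\<close>

lemma permutes_extending_list:
  assumes "distinct xs" "set xs \<subseteq> {1..n}"
  shows "\<exists>p. p permutes {1..n} \<and> (\<forall>i<length xs. p (Suc i) = xs ! i)"
  using assms
proof (induction xs rule: rev_induct)
  case Nil
  show ?case by (intro exI[of _ id] conjI permutes_id) simp
next
  case (snoc x xs)
  then obtain p where p: "p permutes {1..n}" "\<And>i. i < length xs \<Longrightarrow> p (Suc i) = xs ! i" by auto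
  have "card (set (xs @ [x])) \<le> card {1..n}"
    using snoc.prems by (intro card_mono) auto
  then have len: "Suc (length xs) \<le> n" using distinct_card[OF snoc.prems(1)] by simp
  define y where "y = p (Suc (length xs))"
  have y: "y \<in> {1..n}" using len permutes_in_image[OF p(1), of "Suc (length xs)"] by (simp add: y_def)
  have ne: "xs ! i \<noteq> y" "xs ! i \<noteq> x" if "i < length xs" for i
  proof -
    have "p (Suc i) \<noteq> p (Suc (length xs))"
      using that permutes_inj[OF p(1)] by (auto simp: inj_eq)
    then show "xs ! i \<noteq> y" using p(2) that by (simp add: y_def)
    show "xs ! i \<noteq> x" using that snoc.prems(1) nth_mem by fastforce
  qed
  have "transpose y x \<circ> p permutes {1..n}"
    using y snoc.prems by (intro permutes_compose p permutes_swap_id) auto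
  moreover have "(transpose y x \<circ> p) (Suc i) = (xs @ [x]) ! i" if "i < length (xs @ [x])" for i
    using that p(2) ne[of i]
    by (auto simp: nth_append less_Suc_eq transpose_apply_other y_def[symmetric])
  ultimately show ?case by blast
qed


section \<open>Conjugation\<close>

context group
begin

abbreviation conjugate :: "'a \<Rightarrow> 'a \<Rightarrow> 'a"
  where "conjugate g x \<equiv> g \<otimes> x \<otimes> inv g"

lemma conj_mult:
  "g \<in> carrier G \<Longrightarrow> x \<in> carrier G \<Longrightarrow> y \<in> carrier G \<Longrightarrow> conjugate g (x \<otimes> y) = conjugate g x \<otimes> conjugate g y"
  by (simp add: m_assoc inv_solve_left)

lemma conj_conj:
  "g \<in> carrier G \<Longrightarrow> h \<in> carrier G \<Longrightarrow> x \<in> carrier G \<Longrightarrow> conjugate g (conjugate h x) = conjugate (g \<otimes> h) x"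
  by (simp add: m_assoc inv_mult_group)

lemma conj_inv:
  "g \<in> carrier G \<Longrightarrow> x \<in> carrier G \<Longrightarrow> conjugate g (inv x) = inv (conjugate g x)"
  by (simp add: m_assoc inv_mult_group)

lemma conj_commute:
  assumes "x \<otimes> y = y \<otimes> x" "g \<in> carrier G" "x \<in> carrier G" "y \<in> carrier G"
  shows "conjugate g x \<otimes> conjugate g y = conjugate g y \<otimes> conjugate g x"
  using assms by (metis conj_mult)

lemma inv_commute:
  assumes "x \<otimes> y = y \<otimes> x" "x \<in> carrier G" "y \<in> carrier G"
  shows "inv x \<otimes> y = y \<otimes> inv x"
  using assms by (metis inv_closed inv_solve_left inv_solve_right m_assoc m_closed)

end


section \<open>Virtual twin relations\<close>

text \<open>
  The relations of the virtual twin group, with \<open>s i\<close> for \<open>\<sigma> i\<close> and \<open>r i\<close> for \<open>\<rho> i\<close>.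
\<close>

locale virtual_twin = symmetric_generators G n r for G (structure) and n r +
  fixes s :: "nat \<Rightarrow> 'a"
  assumes s_closed: "1 \<le> i \<Longrightarrow> i < n \<Longrightarrow> s i \<in> carrier G"
    and s_square: "1 \<le> i \<Longrightarrow> i < n \<Longrightarrow> s i \<otimes> s i = \<one>"
    and s_far: "1 \<le> i \<Longrightarrow> i + 2 \<le> j \<Longrightarrow> j < n \<Longrightarrow> s i \<otimes> s j = s j \<otimes> s i"
    and rs_far: "1 \<le> i \<Longrightarrow> i < n \<Longrightarrow> 1 \<le> j \<Longrightarrow> j < n \<Longrightarrow> i + 2 \<le> j \<or> j + 2 \<le> i \<Longrightarrow>
      r i \<otimes> s j = s j \<otimes> r i"
    and rrs: "1 \<le> i \<Longrightarrow> Suc i < n \<Longrightarrow> r i \<otimes> r (Suc i) \<otimes> s i = s (Suc i) \<otimes> r i \<otimes> r (Suc i)"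
begin

definition a :: "nat \<Rightarrow> 'a"
  where "a i = s i \<otimes> r i"

text \<open>
  In the indexing by pairs of points, \<open>a i\<close> is the element for \<open>(i, i + 1)\<close>, and \<open>b i\<close> is the one for
  \<open>(i, i + 2)\<close>, since \<open>r i\<close> exchanges \<open>i\<close> and \<open>i + 1\<close>.
\<close>

definition b :: "nat \<Rightarrow> 'a"
  where "b i = r i \<otimes> a (Suc i) \<otimes> r i"

lemma inv_s: "1 \<le> i \<Longrightarrow> i < n \<Longrightarrow> inv (s i) = s i"
  by (simp add: inv_equality s_closed s_square)

lemma a_closed: "1 \<le> i \<Longrightarrow> i < n \<Longrightarrow> a i \<in> carrier G"
  by (simp add: a_def s_closed r_closed)

lemma b_closed: "1 \<le> i \<Longrightarrow> Suc i < n \<Longrightarrow> b i \<in> carrier G"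
  by (simp add: b_def a_closed r_closed)

lemma conj_r_a: "1 \<le> i \<Longrightarrow> i < n \<Longrightarrow> conjugate (r i) (a i) = inv (a i)"
  by (simp add: a_def m_assoc inv_mult_group s_closed r_closed inv_r inv_s r_square)

text \<open>
  The mixed relation is what makes all \<open>a i\<close> conjugate to each other.
\<close>

lemma conj_rr_a:
  assumes "1 \<le> i" "Suc i < n"
  shows "conjugate (r i \<otimes> r (Suc i)) (a i) = a (Suc i)"
proof -
  have c: "r i \<in> carrier G" "s i \<in> carrier G" "r (Suc i) \<in> carrier G" "s (Suc i) \<in> carrier G"
    using assms by (auto simp: r_closed s_closed)
  have "conjugate (r i \<otimes> r (Suc i)) (a i) = (r i \<otimes> r (Suc i) \<otimes> s i) \<otimes> (r i \<otimes> r (Suc i) \<otimes> r i)"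
    using c assms by (simp add: a_def m_assoc inv_mult_group inv_r)
  also have "\<dots> = s (Suc i) \<otimes> (r i \<otimes> r (Suc i)) \<otimes> (r (Suc i) \<otimes> r i \<otimes> r (Suc i))"
    unfolding rrs[OF assms] r_braid[OF assms] using c by (simp add: m_assoc)
  also have "\<dots> = a (Suc i)"
    using c assms by (simp add: a_def m_assoc r_cancel)
  finally show ?thesis .
qed

lemma rrs':
  assumes "1 \<le> i" "Suc i < n"
  shows "r (Suc i) \<otimes> r i \<otimes> s (Suc i) = s i \<otimes> r (Suc i) \<otimes> r i"
proof -
  have "inv (r i \<otimes> r (Suc i) \<otimes> s i) = inv (s (Suc i) \<otimes> r i \<otimes> r (Suc i))"
    using assms by (simp add: rrs)
  then show ?thesis
    using assms by (simp add: inv_mult_group r_closed s_closed inv_r inv_s m_assoc)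
qed

text \<open>
  In this lemma and the three that follow, the generators \<open>s i\<close> are replaced by \<open>a i \<otimes> r i\<close> and the
  factors \<open>r i\<close> are collected on the right.  The same product of the \<open>r i\<close> appears in every case, so it
  cancels when two sides of a relation are compared.
\<close>

lemma rss_eq:
  assumes "1 \<le> i" "Suc i < n"
  shows "r i \<otimes> s (Suc i) \<otimes> s i = b i \<otimes> a (Suc i) \<otimes> (r i \<otimes> r (Suc i) \<otimes> r i)"
proof -
  have c: "r i \<in> carrier G" "s i \<in> carrier G" "r (Suc i) \<in> carrier G" "s (Suc i) \<in> carrier G"
    using assms by (auto simp: r_closed s_closed)
  have "b i \<otimes> a (Suc i) \<otimes> (r i \<otimes> r (Suc i) \<otimes> r i) =
      b i \<otimes> conjugate (r i \<otimes> r (Suc i)) (a i) \<otimes> (r i \<otimes> r (Suc i) \<otimes> r i)"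
    using assms by (simp only: conj_rr_a)
  also have "\<dots> = r i \<otimes> s (Suc i) \<otimes> s i"
    using c assms by (simp add: a_def b_def m_assoc inv_mult_group inv_r r_cancel r_square)
  finally show ?thesis by simp
qed

lemma ssr_eq:
  assumes "1 \<le> i" "Suc i < n"
  shows "s (Suc i) \<otimes> s i \<otimes> r (Suc i) = a (Suc i) \<otimes> b i \<otimes> (r i \<otimes> r (Suc i) \<otimes> r i)"
proof -
  have c: "r i \<in> carrier G" "s i \<in> carrier G" "r (Suc i) \<in> carrier G" "s (Suc i) \<in> carrier G"
    using assms by (auto simp: r_closed s_closed)
  have "a (Suc i) \<otimes> b i \<otimes> (r i \<otimes> r (Suc i) \<otimes> r i) =
      s (Suc i) \<otimes> (r (Suc i) \<otimes> r i \<otimes> s (Suc i)) \<otimes> r i"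
    using c assms by (simp add: a_def b_def m_assoc r_cancel)
  also have "\<dots> = s (Suc i) \<otimes> (s i \<otimes> r (Suc i) \<otimes> r i) \<otimes> r i"
    by (simp only: rrs'[OF assms])
  also have "\<dots> = s (Suc i) \<otimes> s i \<otimes> r (Suc i)"
    using c assms by (simp add: m_assoc r_square)
  finally show ?thesis by simp
qed

lemma sss_eq:
  assumes "1 \<le> i" "Suc i < n"
  shows "s i \<otimes> s (Suc i) \<otimes> s i = a i \<otimes> b i \<otimes> a (Suc i) \<otimes> (r i \<otimes> r (Suc i) \<otimes> r i)"
proof -
  have c: "r i \<in> carrier G" "s i \<in> carrier G" "r (Suc i) \<in> carrier G" "s (Suc i) \<in> carrier G"
      "b i \<in> carrier G" "a (Suc i) \<in> carrier G" "a i \<in> carrier G"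
    using assms by (auto simp: r_closed s_closed a_closed b_closed)
  have "s i \<otimes> s (Suc i) \<otimes> s i = a i \<otimes> (r i \<otimes> s (Suc i) \<otimes> s i)"
    using c assms by (simp add: a_def m_assoc r_cancel)
  also have "\<dots> = a i \<otimes> b i \<otimes> a (Suc i) \<otimes> (r i \<otimes> r (Suc i) \<otimes> r i)"
    unfolding rss_eq[OF assms] using c by (simp add: m_assoc)
  finally show ?thesis .
qed

lemma sss_eq':
  assumes "1 \<le> i" "Suc i < n"
  shows "s (Suc i) \<otimes> s i \<otimes> s (Suc i) = a (Suc i) \<otimes> b i \<otimes> a i \<otimes> (r i \<otimes> r (Suc i) \<otimes> r i)"
proof -
  have c: "r i \<in> carrier G" "s i \<in> carrier G" "r (Suc i) \<in> carrier G" "s (Suc i) \<in> carrier G"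
      "b i \<in> carrier G" "a (Suc i) \<in> carrier G" "a i \<in> carrier G"
    using assms by (auto simp: r_closed s_closed a_closed b_closed)
  have "s (Suc i) \<otimes> s i \<otimes> s (Suc i) = (s (Suc i) \<otimes> s i \<otimes> r (Suc i)) \<otimes> (r (Suc i) \<otimes> s (Suc i))"
    using c assms by (simp add: m_assoc r_cancel)
  also have "\<dots> = a (Suc i) \<otimes> b i \<otimes> (r i \<otimes> r (Suc i) \<otimes> r i) \<otimes> (r (Suc i) \<otimes> s (Suc i))"
    by (simp only: ssr_eq[OF assms])
  also have "\<dots> = a (Suc i) \<otimes> b i \<otimes> (r (Suc i) \<otimes> r i \<otimes> s (Suc i))"
    using c assms by (subst r_braid) (auto simp: m_assoc r_cancel)
  also have "\<dots> = a (Suc i) \<otimes> b i \<otimes> (s i \<otimes> r (Suc i) \<otimes> r i)"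
    by (simp only: rrs'[OF assms])
  also have "\<dots> = a (Suc i) \<otimes> b i \<otimes> a i \<otimes> (r i \<otimes> r (Suc i) \<otimes> r i)"
    using c assms by (simp add: m_assoc r_cancel a_def)
  finally show ?thesis .
qed

lemma r_a_far:
  assumes "1 \<le> i" "i + 2 \<le> j" "j < n"
  shows "r j \<otimes> a i = a i \<otimes> r j"
proof -
  have c: "r i \<in> carrier G" "s i \<in> carrier G" "r j \<in> carrier G"
    using assms by (auto simp: r_closed s_closed)
  moreover have "r j \<otimes> s i = s i \<otimes> r j" "r i \<otimes> r j = r j \<otimes> r i"
    using assms by (auto intro: rs_far r_far)
  ultimately show ?thesis unfolding a_def by (metis m_assoc)
qed

lemma a_far:
  assumes "1 \<le> i" "i + 2 \<le> j" "j < n"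
  shows "a i \<otimes> a j = a j \<otimes> a i"
proof -
  have c: "r i \<in> carrier G" "s i \<in> carrier G" "r j \<in> carrier G" "s j \<in> carrier G" "a i \<in> carrier G"
    using assms by (auto simp: r_closed s_closed a_closed)
  moreover have "s i \<otimes> s j = s j \<otimes> s i" "r i \<otimes> s j = s j \<otimes> r i"
    using assms by (auto intro: rs_far s_far)
  ultimately have "a i \<otimes> s j = s j \<otimes> a i" unfolding a_def by (metis m_assoc)
  moreover have "r j \<otimes> a i = a i \<otimes> r j" using assms by (rule r_a_far)
  ultimately show ?thesis using c unfolding a_def[of j] by (metis m_assoc)
qed

end


section \<open>The pure subgroup of a flat welded braid group\<close>

text \<open>
  What \<open>FWB\<close> contributes to the commutativity of its pure subgroup: the welded relation, the map \<open>\<pi>\<close>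
  to the symmetric group, and generation by the \<open>s i\<close> and \<open>r i\<close>.  For \<open>n \<ge> 2\<close> the element \<open>a 1\<close>, from
  which the family \<open>lam\<close> is built, exists.
\<close>

locale flat_welded =
  virtual_twin G n r s + symmetric_generators_hom G n r \<pi>
  for G (structure) and n r s \<pi> +
  assumes rss: "1 \<le> i \<Longrightarrow> Suc i < n \<Longrightarrow> r i \<otimes> s (Suc i) \<otimes> s i = s (Suc i) \<otimes> s i \<otimes> r (Suc i)"
    and \<pi>_s: "1 \<le> i \<Longrightarrow> i < n \<Longrightarrow> \<pi> (s i) = transpose i (Suc i)"
    and generated: "carrier G = generate G (r ` {1..<n} \<union> s ` {1..<n})"
    and two_le: "2 \<le> n"
begin

text \<open>
  The welded relation expressed in the pure subgroup.
\<close>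

lemma b_a_commute:
  assumes "1 \<le> i" "Suc i < n"
  shows "b i \<otimes> a (Suc i) = a (Suc i) \<otimes> b i"
proof -
  have "b i \<otimes> a (Suc i) \<otimes> (r i \<otimes> r (Suc i) \<otimes> r i) = a (Suc i) \<otimes> b i \<otimes> (r i \<otimes> r (Suc i) \<otimes> r i)"
    using rss[OF assms] by (simp only: rss_eq[OF assms] ssr_eq[OF assms])
  then show ?thesis using assms by (subst (asm) right_cancel) (auto simp: a_closed b_closed r_closed)
qed

lemma tail1_closed: "g \<in> tail 1 \<Longrightarrow> g \<in> carrier G"
  using tail_closed by blast

lemma a1_closed: "a 1 \<in> carrier G"
  using two_le by (simp add: a_closed)

lemma ex_tail_mapping:
  assumes "distinct xs" "set xs \<subseteq> {1..n}"
  shows "\<exists>g\<in>tail 1. \<forall>i<length xs. \<pi> g (Suc i) = xs ! i"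
  using permutes_extending_list[OF assms] \<pi>_onto by metis

text \<open>
  The conjugate of \<open>a 1\<close>, which belongs to the pair \<open>(1, 2)\<close>, by any element of \<open>tail 1\<close> that moves this
  pair to \<open>(k, l)\<close>; the choice does not matter, by \<open>conj_a_well_defined\<close>.
\<close>

definition lam :: "nat \<Rightarrow> nat \<Rightarrow> 'a"
  where "lam k l = conjugate (SOME g. g \<in> tail 1 \<and> \<pi> g 1 = k \<and> \<pi> g 2 = l) (a 1)"

text \<open>
  Two such elements differ by one that fixes \<open>1\<close> and \<open>2\<close>.  By \<open>pointwise_stabilizer\<close> it is a product of
  generators \<open>r j\<close> with \<open>j \<ge> 3\<close>, and these commute with \<open>a 1\<close>.
\<close>

lemma conj_a_well_defined:
  assumes "g \<in> tail 1" "h \<in> tail 1" "\<pi> g 1 = \<pi> h 1" "\<pi> g 2 = \<pi> h 2"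
  shows "conjugate g (a 1) = conjugate h (a 1)"
proof -
  define w where "w = inv h \<otimes> g"
  have c: "g \<in> carrier G" "h \<in> carrier G" "w \<in> carrier G"
    using assms tail1_closed by (auto simp: w_def)
  have g: "g = h \<otimes> w" using c by (simp add: w_def m_assoc[symmetric])
  have "\<pi> (inv h) \<circ> \<pi> h = id" using c by (simp add: \<pi>_inv)
  then have "\<pi> w 1 = 1" "\<pi> w 2 = 2"
    using assms c by (simp_all add: w_def \<pi>_mult pointfree_idE)
  moreover have "w \<in> tail 1" unfolding w_def using assms by (intro tail_mult tail_inv) auto
  ultimately have "w \<in> tail (Suc 2)"
    by (intro pointwise_stabilizer) (auto simp: numeral_2_eq_2 less_Suc_eq)
  then have "w \<otimes> a 1 = a 1 \<otimes> w"
    unfolding tail_def by (rule generate_commute[rotated]) (auto simp: r_closed a1_closed[simplified] intro!: r_a_far)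
  then have "conjugate w (a 1) = a 1" using c a1_closed by (simp add: m_assoc)
  then show ?thesis using c a1_closed conj_conj[of h w "a 1"] by (simp add: g)
qed

lemma lam_conj:
  assumes "g \<in> tail 1" "\<pi> g 1 = k" "\<pi> g 2 = l"
  shows "lam k l = conjugate g (a 1)"
  unfolding lam_def
proof (rule someI2[of _ g])
  fix h assume "h \<in> tail 1 \<and> \<pi> h 1 = k \<and> \<pi> h 2 = l"
  then show "conjugate h (a 1) = conjugate g (a 1)"
    by (intro conj_a_well_defined) (simp_all only: assms)
qed (simp only: assms)

lemma ex_lam_conj:
  assumes "k \<in> {1..n}" "l \<in> {1..n}" "k \<noteq> l"
  obtains g where "g \<in> tail 1" "\<pi> g 1 = k" "\<pi> g 2 = l" "lam k l = conjugate g (a 1)"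
proof -
  obtain g where g: "g \<in> tail 1" "\<forall>i<length [k, l]. \<pi> g (Suc i) = [k, l] ! i"
    using ex_tail_mapping[of "[k, l]"] assms by auto
  from g(2) have "\<pi> g 1 = k" "\<pi> g 2 = l" by (auto simp: All_less_Suc2 numeral_2_eq_2)
  with g(1) show thesis using that lam_conj[OF g(1)] by metis
qed

lemma lam_closed: "k \<in> {1..n} \<Longrightarrow> l \<in> {1..n} \<Longrightarrow> k \<noteq> l \<Longrightarrow> lam k l \<in> carrier G"
  by (erule (2) ex_lam_conj) (auto simp: a1_closed[simplified] tail1_closed[simplified])

lemma conj_lam:
  assumes "h \<in> tail 1" "k \<in> {1..n}" "l \<in> {1..n}" "k \<noteq> l"
  shows "conjugate h (lam k l) = lam (\<pi> h k) (\<pi> h l)"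
proof -
  obtain g where g: "g \<in> tail 1" "\<pi> g 1 = k" "\<pi> g 2 = l" "lam k l = conjugate g (a 1)"
    using ex_lam_conj assms by metis
  have c: "g \<in> carrier G" "h \<in> carrier G" using g assms tail1_closed by auto
  have "lam (\<pi> h k) (\<pi> h l) = conjugate (h \<otimes> g) (a 1)"
    using g assms c by (intro lam_conj tail_mult) (auto simp: \<pi>_mult)
  also have "\<dots> = conjugate h (lam k l)"
    using conj_conj[OF c(2,1) a1_closed] g by simp
  finally show ?thesis by simp
qed

lemma lam_Suc: "1 \<le> i \<Longrightarrow> i < n \<Longrightarrow> lam i (Suc i) = a i"
proof (induction i rule: nat_induct_at_least)
  case base
  show ?case using lam_conj[of \<one> 1 2] a1_closed by (simp add: tail_one \<pi>_one numeral_2_eq_2)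
next
  case (Suc i)
  have c: "r i \<in> carrier G" "r (Suc i) \<in> carrier G" using Suc by (auto simp: r_closed)
  have "a (Suc i) = conjugate (r i \<otimes> r (Suc i)) (lam i (Suc i))"
    using Suc by (simp add: conj_rr_a)
  also have "\<dots> = lam (\<pi> (r i \<otimes> r (Suc i)) i) (\<pi> (r i \<otimes> r (Suc i)) (Suc i))"
    using Suc by (intro conj_lam tail_mult r_in_tail) auto
  also have "\<dots> = lam (Suc i) (Suc (Suc i))"
    using Suc c by (simp add: \<pi>_mult \<pi>_r transpose_apply_other)
  finally show ?case by simp
qed

lemma lam_swap:
  assumes "k \<in> {1..n}" "l \<in> {1..n}" "k \<noteq> l"
  shows "lam l k = inv (lam k l)"
proof -
  obtain g where g: "g \<in> tail 1" "\<pi> g 1 = k" "\<pi> g 2 = l" "lam k l = conjugate g (a 1)"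
    using ex_lam_conj assms by metis
  have c: "g \<in> carrier G" "r 1 \<in> carrier G" "r 1 \<in> tail 1"
    using g two_le tail1_closed r_closed[of 1] r_in_tail[of 1 1] by auto
  have "lam l k = conjugate (g \<otimes> r 1) (a 1)"
    using g c two_le \<pi>_r[of 1] by (intro lam_conj tail_mult) (auto simp: \<pi>_mult numeral_2_eq_2)
  also have "\<dots> = conjugate g (conjugate (r 1) (a 1))"
    using conj_conj[OF c(1,2) a1_closed] by simp
  also have "\<dots> = inv (conjugate g (a 1))"
    using two_le conj_inv[OF c(1) a1_closed] conj_r_a[of 1] by simp
  finally show ?thesis by (simp add: g)
qed

text \<open>
  Symmetry reduces this to the elements \<open>a 1\<close> and \<open>a 3\<close> for the pairs \<open>(1, 2)\<close> and \<open>(3, 4)\<close>.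
\<close>

lemma lam_commute_disjoint:
  assumes "distinct [w, x, y, z]" "set [w, x, y, z] \<subseteq> {1..n}"
  shows "lam w x \<otimes> lam y z = lam y z \<otimes> lam w x"
proof -
  obtain g where g: "g \<in> tail 1" "\<forall>i<length [w, x, y, z]. \<pi> g (Suc i) = [w, x, y, z] ! i"
    using ex_tail_mapping[OF assms] by auto
  from g(2) have \<pi>: "\<pi> g 1 = w" "\<pi> g 2 = x" "\<pi> g 3 = y" "\<pi> g 4 = z"
    by (auto simp: All_less_Suc2 numeral_2_eq_2 numeral_3_eq_3 eval_nat_numeral)
  have "card (set [w, x, y, z]) \<le> card {1..n}" using assms(2) by (intro card_mono) auto
  then have n: "4 \<le> n" unfolding distinct_card[OF assms(1)] by simp
  have a: "lam 1 2 = a 1" "lam 3 4 = a 3"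
    using n lam_Suc[of 1] lam_Suc[of 3] by (auto simp: numeral_2_eq_2)
  have "conjugate g (a 1) \<otimes> conjugate g (a 3) = conjugate g (a 3) \<otimes> conjugate g (a 1)"
    using n g tail1_closed by (intro conj_commute a_far a_closed) auto
  moreover have "conjugate g (a 1) = lam w x" "conjugate g (a 3) = lam y z"
    unfolding a[symmetric] using n conj_lam[OF g(1)] \<pi> by auto
  ultimately show ?thesis by simp
qed

text \<open>
  Symmetry reduces this to the elements \<open>b 1\<close> and \<open>a 2\<close> for the pairs \<open>(1, 3)\<close> and \<open>(2, 3)\<close>.
\<close>

lemma lam_commute_common_end:
  assumes "distinct [x, y, z]" "set [x, y, z] \<subseteq> {1..n}"
  shows "lam x z \<otimes> lam y z = lam y z \<otimes> lam x z"
proof -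
  obtain g where g: "g \<in> tail 1" "\<forall>i<length [x, y, z]. \<pi> g (Suc i) = [x, y, z] ! i"
    using ex_tail_mapping[OF assms] by auto
  from g(2) have \<pi>: "\<pi> g 1 = x" "\<pi> g 2 = y" "\<pi> g 3 = z"
    by (auto simp: All_less_Suc2 numeral_2_eq_2 numeral_3_eq_3 eval_nat_numeral)
  have "card (set [x, y, z]) \<le> card {1..n}" using assms(2) by (intro card_mono) auto
  then have n: "3 \<le> n" unfolding distinct_card[OF assms(1)] by simp
  have a: "lam 2 3 = a 2" using n lam_Suc[of 2] by simp
  have "b 1 = conjugate (r 1) (a 2)" using n by (simp add: b_def inv_r numeral_2_eq_2)
  also have "\<dots> = lam (\<pi> (r 1) 2) (\<pi> (r 1) 3)"
    unfolding a[symmetric] using n by (intro conj_lam r_in_tail) auto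
  also have "\<dots> = lam 1 3"
    using n \<pi>_r[of 1] by (simp add: numeral_2_eq_2 transpose_apply_other)
  finally have b: "lam 1 3 = b 1" by simp
  have "conjugate g (b 1) \<otimes> conjugate g (a 2) = conjugate g (a 2) \<otimes> conjugate g (b 1)"
    using n g tail1_closed b_a_commute[of 1]
    by (intro conj_commute a_closed b_closed) (auto simp: numeral_2_eq_2)
  moreover have "conjugate g (b 1) = lam x z" "conjugate g (a 2) = lam y z"
    unfolding a[symmetric] b[symmetric] using n conj_lam[OF g(1)] \<pi> by auto
  ultimately show ?thesis by simp
qed

text \<open>
  Reversing a pair inverts the element, so every two pairs that share exactly one point can be oriented
  so that they end in the common point.
\<close>

lemma lam_commute:
  assumes "k \<in> {1..n}" "l \<in> {1..n}" "k \<noteq> l" "k' \<in> {1..n}" "l' \<in> {1..n}" "k' \<noteq> l'"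
  shows "lam k l \<otimes> lam k' l' = lam k' l' \<otimes> lam k l"
proof -
  have c: "lam k l \<in> carrier G" "lam k' l' \<in> carrier G" "lam l k \<in> carrier G" "lam l' k' \<in> carrier G"
    using assms by (auto intro: lam_closed)
  have sw: "lam k l = inv (lam l k)" "lam k' l' = inv (lam l' k')"
    using assms by (auto intro: lam_swap)
  consider "k = k'" "l = l'" | "k = l'" "l = k'" | "k \<noteq> k'" "l = l'" | "k = k'" "l \<noteq> l'"
    | "l = k'" "k \<noteq> l'" | "k = l'" "l \<noteq> k'" | "distinct [k, l, k', l']"
    using assms by auto
  then show ?thesis
  proof cases
    case 2
    then show ?thesis using sw c by (metis l_inv r_inv)
  next
    case 3
    then show ?thesis using assms lam_commute_common_end[of k k' l] by auto
  next
    case 4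
    then have "lam l k \<otimes> lam l' k' = lam l' k' \<otimes> lam l k"
      using assms lam_commute_common_end[of l l' k] by auto
    then show ?thesis using sw c by (metis inv_commute)
  next
    case 5
    then have "lam k l \<otimes> lam l' k' = lam l' k' \<otimes> lam k l"
      using assms lam_commute_common_end[of k l' l] by auto
    then show ?thesis using sw c by (metis inv_commute)
  next
    case 6
    then have "lam l k \<otimes> lam k' l' = lam k' l' \<otimes> lam l k"
      using assms lam_commute_common_end[of l k' k] by auto
    then show ?thesis using sw c by (metis inv_commute)
  next
    case 7
    then show ?thesis using assms lam_commute_disjoint[of k l k' l'] by auto
  qed simp
qed

definition lams :: "'a set"
  where "lams = {lam k l | k l. k \<in> {1..n} \<and> l \<in> {1..n} \<and> k \<noteq> l}"

lemma lams_carrier: "lams \<subseteq> carrier G"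
  using lam_closed by (auto simp: lams_def)

lemma generate_lams_commute:
  assumes "x \<in> generate G lams" "y \<in> generate G lams"
  shows "x \<otimes> y = y \<otimes> x"
proof (rule generate_commute[OF lams_carrier assms(1)])
  show "y \<in> carrier G" using assms lams_carrier generate_in_carrier by blast
  fix z assume z: "z \<in> lams"
  have "y \<otimes> z = z \<otimes> y"
    by (rule generate_commute[OF lams_carrier assms(2)])
      (use z lams_carrier in \<open>auto simp: lams_def lam_commute\<close>)
  then show "z \<otimes> y = y \<otimes> z" by simp
qed

lemma conj_generate_lams:
  assumes h: "h \<in> tail 1" and "u \<in> generate G lams"
  shows "conjugate h u \<in> generate G lams"
proof -
  have c: "h \<in> carrier G" using h tail1_closed by simp
  have \<pi>h: "\<pi> h k \<in> {1..n} \<longleftrightarrow> k \<in> {1..n}" "\<pi> h k = \<pi> h l \<longleftrightarrow> k = l" for k l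
    using \<pi>_permutes[OF c] permutes_in_image permutes_inj by (fastforce simp: inj_eq)+
  have L: "conjugate h x \<in> lams" if "x \<in> lams" for x
    using that conj_lam[OF h] \<pi>h unfolding lams_def by blast
  show ?thesis
    using assms(2)
  proof (induction rule: generate.induct)
    case one
    then show ?case using c by (simp add: generate.one)
  next
    case (incl x)
    then show ?case using L by (blast intro: generate.incl)
  next
    case (inv x)
    then have "conjugate h (inv x) = inv (conjugate h x)" using c lams_carrier by (intro conj_inv) auto
    then show ?case using L inv by (simp add: generate.inv)
  next
    case (eng x y)
    then have "conjugate h (x \<otimes> y) = conjugate h x \<otimes> conjugate h y"
      using c generate_in_carrier[OF lams_carrier] by (intro conj_mult) auto
    then show ?case using eng by (simp add: generate.eng)
  qed
qed

text \<open>
  The products on the right absorb a generator \<open>r i\<close> because the first factor is normalized by it, and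
  they absorb \<open>s i = a i \<otimes> r i\<close> because in addition \<open>a i = lam i (i + 1)\<close>.
\<close>

lemma lams_tail_decomposition:
  assumes "g \<in> carrier G"
  obtains u h where "u \<in> generate G lams" "h \<in> tail 1" "g = u \<otimes> h"
proof -
  define D where "D = {u \<otimes> h | u h. u \<in> generate G lams \<and> h \<in> tail 1}"
  have Lc: "u \<in> carrier G" if "u \<in> generate G lams" for u
    using that generate_in_carrier[OF lams_carrier] by blast
  have r: "r i \<otimes> x \<in> D" if i: "1 \<le> i" "i < n" and x: "x \<in> D" for i x
  proof -
    obtain u h where uh: "u \<in> generate G lams" "h \<in> tail 1" "x = u \<otimes> h"
      using x by (auto simp: D_def)
    have rt: "r i \<in> tail 1" using i by (simp add: r_in_tail)
    have c: "u \<in> carrier G" "h \<in> carrier G" "r i \<in> carrier G" using uh Lc tail1_closed rt by auto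
    have "r i \<otimes> x = conjugate (r i) u \<otimes> (r i \<otimes> h)"
      using uh c i by (simp add: m_assoc inv_r r_cancel)
    moreover have "conjugate (r i) u \<in> generate G lams" using rt uh by (intro conj_generate_lams)
    moreover have "r i \<otimes> h \<in> tail 1" using rt uh by (intro tail_mult) auto
    ultimately show ?thesis unfolding D_def by blast
  qed
  have D_closed: "x \<in> carrier G" if "x \<in> D" for x
    using that Lc tail1_closed by (auto simp: D_def)
  have s: "s i \<otimes> x \<in> D" if i: "1 \<le> i" "i < n" and x: "x \<in> D" for i x
  proof -
    obtain u h where uh: "u \<in> generate G lams" "h \<in> tail 1" "r i \<otimes> x = u \<otimes> h"
      using r[OF i x] by (auto simp: D_def)
    have c: "u \<in> carrier G" "h \<in> carrier G" "r i \<in> carrier G" "s i \<in> carrier G" "x \<in> carrier G"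
      using uh Lc tail1_closed i x D_closed by (auto simp: r_closed s_closed)
    have "s i \<otimes> x = a i \<otimes> (r i \<otimes> x)"
      using c i by (simp add: a_def m_assoc r_cancel)
    also have "\<dots> = (a i \<otimes> u) \<otimes> h"
      using c i by (simp add: uh m_assoc a_closed)
    finally have "s i \<otimes> x = (a i \<otimes> u) \<otimes> h" .
    moreover have "a i \<in> lams"
      unfolding lams_def using i lam_Suc[of i, symmetric] by force
    then have "a i \<otimes> u \<in> generate G lams" using uh by (simp add: generate.eng generate.incl)
    ultimately show ?thesis using uh unfolding D_def by blast
  qed
  have "\<one> \<otimes> \<one> \<in> D" unfolding D_def using generate.one tail_one by blast
  then have "g \<in> D"
    using assms unfolding generated
    by (elim generate_involutions_induct)
      (auto simp: r_closed s_closed inv_r inv_s D_closed r s)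
  then show thesis using that by (auto simp: D_def)
qed

lemma \<pi>_generate_lams:
  assumes "u \<in> generate G lams"
  shows "\<pi> u = id"
proof -
  have L: "\<pi> x = id" if x: "x \<in> lams" for x
  proof -
    obtain k l where kl: "k \<in> {1..n}" "l \<in> {1..n}" "k \<noteq> l" "x = lam k l"
      using x by (auto simp: lams_def)
    obtain g where g: "g \<in> tail 1" "x = conjugate g (a 1)"
      using ex_lam_conj[OF kl(1-3)] kl(4) by metis
    have c: "g \<in> carrier G" "r 1 \<in> carrier G" "s 1 \<in> carrier G"
      using g tail1_closed two_le by (auto simp: r_closed s_closed)
    have "\<pi> (a 1) = id" using c two_le \<pi>_r[of 1] \<pi>_s[of 1] by (simp add: a_def \<pi>_mult)
    moreover have "\<pi> g \<circ> \<pi> (inv g) = id" using c by (simp add: \<pi>_inv)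
    ultimately show ?thesis using g c a1_closed by (simp add: \<pi>_mult)
  qed
  show ?thesis
    using assms
  proof (induction rule: generate.induct)
    case (inv x)
    then have "x \<in> carrier G" using lams_carrier by auto
    then have "\<pi> (inv x) \<circ> \<pi> x = id" by (simp add: \<pi>_inv)
    then show ?case using L inv by simp
  next
    case (eng x y)
    then show ?case using generate_in_carrier[OF lams_carrier] by (simp add: \<pi>_mult)
  qed (simp_all add: \<pi>_one L)
qed

text \<open>
  The first factor of the decomposition is in the kernel, so the permutation of the second one is
  trivial, and then the second factor is trivial by faithfulness.
\<close>

lemma kernel_subset_generate_lams: "kernel G (sym_group n) \<pi> \<subseteq> generate G lams"
proof
  fix g assume "g \<in> kernel G (sym_group n) \<pi>"
  then have g: "g \<in> carrier G" "\<pi> g = id" by (auto simp: kernel_def sym_group_one)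
  then obtain u h where uh: "u \<in> generate G lams" "h \<in> tail 1" "g = u \<otimes> h"
    using lams_tail_decomposition by metis
  have c: "u \<in> carrier G" "h \<in> carrier G"
    using uh generate_in_carrier[OF lams_carrier] tail1_closed by auto
  have "\<pi> h = id" using g uh c \<pi>_generate_lams by (simp add: \<pi>_mult)
  then have "h = \<one>" using \<pi>_faithful uh by blast
  then show "g \<in> generate G lams" using uh c by simp
qed

theorem kernel_commutative:
  "x \<in> kernel G (sym_group n) \<pi> \<Longrightarrow> y \<in> kernel G (sym_group n) \<pi> \<Longrightarrow> x \<otimes> y = y \<otimes> x"
  using kernel_subset_generate_lams generate_lams_commute by blast

end


section \<open>Classes of words in a presented group\<close>

abbreviation gen_class :: "'a set \<Rightarrow> ('a word \<times> 'a word) set \<Rightarrow> 'a \<Rightarrow> 'a word set"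
  where "gen_class X R x \<equiv> word_cong X R `` {[(x, True)]}"

lemma rel_class_eq:
  assumes "(u, v) \<in> R" "u \<in> words X" "v \<in> words X"
  shows "word_cong X R `` {u} = word_cong X R `` {v}"
  using assms by (simp add: class_eq_iff word_cong.rel)

lemma gen_class_closed: "x \<in> X \<Longrightarrow> gen_class X R x \<in> carrier (presented_group X R)"
  by (simp add: class_in_carrier)

lemma class_inverse_letter:
  assumes "x \<in> X"
  shows "word_cong X R `` {[(x, False)]} = inv\<^bsub>presented_group X R\<^esub> gen_class X R x"
proof (rule group.inv_equality[OF group_presented_group, symmetric])
  show "word_cong X R `` {[(x, False)]} \<otimes>\<^bsub>presented_group X R\<^esub> gen_class X R x =
      \<one>\<^bsub>presented_group X R\<^esub>"
    using assms word_cong.cancel[of x X False R] by (simp add: mult_class one_class class_eq_iff)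
qed (use assms in \<open>simp_all add: class_in_carrier\<close>)

lemma class_Cons:
  assumes "x \<in> X" "w \<in> words X"
  shows "word_cong X R `` {(x, b) # w} =
    (if b then gen_class X R x else inv\<^bsub>presented_group X R\<^esub> gen_class X R x)
      \<otimes>\<^bsub>presented_group X R\<^esub> word_cong X R `` {w}"
proof -
  have "word_cong X R `` {(x, b) # w} =
      word_cong X R `` {[(x, b)]} \<otimes>\<^bsub>presented_group X R\<^esub> word_cong X R `` {w}"
    using assms by (simp add: mult_class)
  then show ?thesis using assms by (cases b) (simp_all add: class_inverse_letter)
qed

text \<open>
  A homomorphism out of a presented group is determined by its values on the generators.
\<close>

lemma word_value_hom_class:
  assumes "group H" "h \<in> hom (presented_group X R) H" "w \<in> words X"
  shows "word_value H (\<lambda>x. h (gen_class X R x)) w = h (word_cong X R `` {w})"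
proof -
  interpret h: group_hom "presented_group X R" H h
    using assms by (simp add: group_hom_def group_hom_axioms_def group_presented_group)
  show ?thesis
    using assms(3)
  proof (induction w)
    case Nil
    then show ?case using h.hom_one by (simp add: one_class)
  next
    case (Cons l w)
    obtain x b where l: "l = (x, b)" by force
    with Cons.prems have xw: "x \<in> X" "w \<in> words X" by auto
    then have "gen_class X R x \<in> carrier (presented_group X R)"
        "word_cong X R `` {w} \<in> carrier (presented_group X R)"
      by (auto intro: class_in_carrier)
    with Cons.IH xw show ?case
      by (simp only: l word_value_Cons class_Cons) (simp add: h.hom_mult)
  qed
qed

lemma presented_group_generated:
  "carrier (presented_group X R) = generate (presented_group X R) (gen_class X R ` X)"
proof
  show "generate (presented_group X R) (gen_class X R ` X) \<subseteq> carrier (presented_group X R)"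
  proof
    fix g assume "g \<in> generate (presented_group X R) (gen_class X R ` X)"
    then show "g \<in> carrier (presented_group X R)"
      by (rule group.generate_in_carrier[OF group_presented_group, rotated])
        (auto intro: gen_class_closed)
  qed
next
  have class_gen: "word_cong X R `` {w} \<in> generate (presented_group X R) (gen_class X R ` X)"
    if "w \<in> words X" for w
    using that
  proof (induction w)
    case Nil
    show ?case unfolding one_class[symmetric] by (rule generate.one)
  next
    case (Cons l w)
    obtain x b where l: "l = (x, b)" by force
    with Cons.prems have xw: "x \<in> X" "w \<in> words X" by auto
    have "(if b then gen_class X R x else inv\<^bsub>presented_group X R\<^esub> gen_class X R x)
        \<in> generate (presented_group X R) (gen_class X R ` X)"
      using xw by (cases b) (simp_all add: generate.incl generate.inv)
    then show ?case
      unfolding l class_Cons[OF xw] using Cons.IH xw by (blast intro: generate.eng)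
  qed
  show "carrier (presented_group X R) \<subseteq> generate (presented_group X R) (gen_class X R ` X)"
  proof
    fix C assume "C \<in> carrier (presented_group X R)"
    then obtain w where "w \<in> words X" "C = word_cong X R `` {w}" by (rule presented_group_cases)
    with class_gen show "C \<in> generate (presented_group X R) (gen_class X R ` X)" by simp
  qed
qed


section \<open>Quotients by the derived subgroup of a normal subgroup\<close>

lemma (in group) derived_coset_commute:
  assumes "P \<lhd> G" "x \<in> P" "y \<in> P"
  shows "derived G P #> (x \<otimes> y) = derived G P #> (y \<otimes> x)"
proof -
  interpret P: normal P G by (rule assms)
  interpret D: normal "derived G P" G by (rule derived_is_normal[OF assms(1)])
  have c: "x \<in> carrier G" "y \<in> carrier G" using assms P.subset by auto
  have "x \<otimes> y \<otimes> inv x \<otimes> inv y \<in> derived G P"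
    unfolding derived_def using assms by (intro generate.incl) blast
  then have "x \<otimes> y \<otimes> inv (y \<otimes> x) \<in> derived G P"
    using c by (simp add: inv_mult_group m_assoc)
  then have "x \<otimes> y \<in> derived G P #> (y \<otimes> x)"
    using c by (intro D.rcos_module_rev is_group) auto
  then show ?thesis using c D.subgroup_axioms by (intro repr_independence[symmetric]) auto
qed

lemma (in group) derived_trivial:
  assumes "P \<subseteq> carrier G" "\<And>x y. x \<in> P \<Longrightarrow> y \<in> P \<Longrightarrow> x \<otimes> y = y \<otimes> x"
  shows "derived G P = {\<one>}"
proof
  have "x \<otimes> y \<otimes> inv x \<otimes> inv y = \<one>" if "x \<in> P" "y \<in> P" for x y
  proof -
    have "x \<in> carrier G" "y \<in> carrier G" using that assms(1) by auto
    then show ?thesis by (subst assms(2)[OF that]) (simp add: m_assoc)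
  qed
  then show "derived G P \<subseteq> {\<one>}"
    unfolding derived_def by (intro generate_subgroup_incl triv_subgroup) blast
  show "{\<one>} \<subseteq> derived G P" unfolding derived_def using generate.one by blast
qed

text \<open>
  Let \<open>\<pi>\<close> be the projection from \<open>G\<close> to its quotient \<open>G'\<close>, and \<open>q\<close> the one from \<open>G\<close> to
  \<open>Q = G Mod derived G P\<close>.  As the relations of \<open>G'\<close> hold in \<open>Q\<close>, there is a homomorphism \<open>\<psi>\<close> from \<open>G'\<close>
  to \<open>Q\<close> with \<open>\<psi> \<circ> \<pi> = q\<close>.  It is onto because \<open>q\<close> is, and its kernel is
  \<open>\<pi> ` derived G P = derived G' (\<pi> ` P) = derived G' P'\<close>.
\<close>

proposition presented_group_Mod_derived_iso:
  fixes X :: "'a set" and R R' :: "('a word \<times> 'a word) set" and P P' :: "'a word set set"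
  defines "G \<equiv> presented_group X R" and "G' \<equiv> presented_group X R'"
  assumes sub: "R \<subseteq> R'"
    and P: "P \<lhd> G" and P': "P' \<subseteq> carrier G'"
    and P_iff: "\<And>w. w \<in> words X \<Longrightarrow> word_cong X R `` {w} \<in> P \<longleftrightarrow> word_cong X R' `` {w} \<in> P'"
    and rel: "\<And>u v. (u, v) \<in> R' \<Longrightarrow> u \<in> words X \<Longrightarrow> v \<in> words X \<Longrightarrow>
      derived G P #>\<^bsub>G\<^esub> word_cong X R `` {u} = derived G P #>\<^bsub>G\<^esub> word_cong X R `` {v}"
  shows "G' Mod derived G' P' \<cong> G Mod derived G P"
proof -
  interpret G: group G unfolding G_def by (rule group_presented_group)
  interpret G': group G' unfolding G'_def by (rule group_presented_group)
  interpret D: normal "derived G P" G by (rule G.derived_is_normal[OF P])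
  define Q where "Q = G Mod derived G P"
  have Q: "group Q" unfolding Q_def by (rule D.factorgroup_is_group)
  define q where "q = (\<lambda>g. derived G P #>\<^bsub>G\<^esub> g)"
  have q: "q \<in> hom G Q" unfolding q_def Q_def by (rule D.r_coset_hom_Mod)
  have Pc: "P \<subseteq> carrier G" using P by (simp add: normal_def subgroup.subset)

  define \<psi> where "\<psi> = induced_hom Q (\<lambda>x. q (gen_class X R x))"
  have f: "(\<lambda>x. q (gen_class X R x)) \<in> X \<rightarrow> carrier Q"
    using q gen_class_closed[of _ X R] unfolding G_def by (auto intro: hom_in_carrier)
  have val_q: "word_value Q (\<lambda>x. q (gen_class X R x)) w = q (word_cong X R `` {w})" if "w \<in> words X" for w
    using word_value_hom_class[OF Q q[unfolded G_def] that] .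
  have respects: "word_value Q (\<lambda>x. q (gen_class X R x)) u = word_value Q (\<lambda>x. q (gen_class X R x)) v"
    if "(u, v) \<in> R'" "u \<in> words X" "v \<in> words X" for u v
    using rel[OF that] that by (simp add: val_q) (simp add: q_def)
  have \<psi>_class: "\<psi> (word_cong X R' `` {w}) = q (word_cong X R `` {w})" if "w \<in> words X" for w
    unfolding \<psi>_def using induced_hom_class[OF Q f respects that] that by (simp add: val_q)
  have "\<psi> \<in> hom G' Q"
    unfolding \<psi>_def G'_def by (rule induced_hom_in_hom[OF Q f respects])
  then interpret \<psi>: group_hom G' Q \<psi>
    by (simp add: group_hom_def group_hom_axioms_def Q G'.is_group)

  define \<pi> where "\<pi> = induced_hom G' (gen_class X R')"
  have f': "gen_class X R' \<in> X \<rightarrow> carrier G'"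
    using gen_class_closed[of _ X R'] unfolding G'_def by auto
  have val_id: "word_value G' (gen_class X R') w = word_cong X R' `` {w}" if "w \<in> words X" for w
    using word_value_hom_class[OF G'.is_group _ that, of "\<lambda>x. x" R'] by (simp add: G'_def hom_def)
  have respects': "word_value G' (gen_class X R') u = word_value G' (gen_class X R') v"
    if "(u, v) \<in> R" "u \<in> words X" "v \<in> words X" for u v
    using that sub rel_class_eq[of u v R' X] by (auto simp: val_id)
  have \<pi>_class: "\<pi> (word_cong X R `` {w}) = word_cong X R' `` {w}" if "w \<in> words X" for w
    unfolding \<pi>_def using induced_hom_class[OF G'.is_group f' respects' that] that by (simp add: val_id)
  have "\<pi> \<in> hom G G'"
    unfolding \<pi>_def G_def by (rule induced_hom_in_hom[OF G'.is_group f' respects'])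
  then interpret \<pi>: group_hom G G' \<pi>
    by (simp add: group_hom_def group_hom_axioms_def G.is_group G'.is_group)

  have \<psi>\<pi>: "\<psi> (\<pi> g) = q g" if "g \<in> carrier G" for g
    using that unfolding G_def by (elim presented_group_cases) (simp add: \<pi>_class \<psi>_class)
  have \<pi>_onto: "\<exists>g\<in>carrier G. g' = \<pi> g" if "g' \<in> carrier G'" for g'
    using that unfolding G'_def
  proof (elim presented_group_cases)
    fix w assume w: "w \<in> words X" "g' = word_cong X R' `` {w}"
    show ?thesis
      by (rule bexI[of _ "word_cong X R `` {w}"]) (use w in \<open>simp_all add: \<pi>_class G_def class_in_carrier\<close>)
  qed
  have \<psi>_onto: "\<psi> ` carrier G' = carrier Q"
  proof
    show "carrier Q \<subseteq> \<psi> ` carrier G'"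
    proof
      fix x assume "x \<in> carrier Q"
      then obtain g where "g \<in> carrier G" "x = q g"
        unfolding Q_def q_def FactGroup_def RCOSETS_def by auto
      then show "x \<in> \<psi> ` carrier G'" using \<psi>\<pi>[of g] by (metis \<pi>.hom_closed image_eqI)
    qed
  qed auto
  have "\<pi> ` P = P'"
  proof (intro equalityI subsetI)
    fix x assume "x \<in> \<pi> ` P"
    then obtain g where g: "g \<in> P" "x = \<pi> g" by blast
    then have "g \<in> carrier (presented_group X R)" using Pc by (auto simp: G_def)
    then obtain w where "w \<in> words X" "g = word_cong X R `` {w}" by (rule presented_group_cases)
    with g show "x \<in> P'" using P_iff by (simp add: \<pi>_class)
  next
    fix x assume x: "x \<in> P'"
    then have "x \<in> carrier (presented_group X R')" using P' by (auto simp: G'_def)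
    then obtain w where w: "w \<in> words X" "x = word_cong X R' `` {w}" by (rule presented_group_cases)
    then have "\<pi> (word_cong X R `` {w}) \<in> \<pi> ` P" using P_iff[of w] x by blast
    then show "x \<in> \<pi> ` P" using w by (simp add: \<pi>_class)
  qed
  then have D': "derived G' P' = \<pi> ` derived G P"
    using \<pi>.derived_img[OF Pc] by simp
  have q_one: "q g = \<one>\<^bsub>Q\<^esub> \<longleftrightarrow> g \<in> derived G P" if "g \<in> carrier G" for g
    using D.rcos_const[OF G.is_group, of g] G.coset_join1[OF _ that D.subgroup_axioms]
    by (auto simp: q_def Q_def)
  have "kernel G' Q \<psi> = derived G' P'"
  proof (intro equalityI subsetI)
    fix x assume "x \<in> kernel G' Q \<psi>"
    then have x: "x \<in> carrier G'" "\<psi> x = \<one>\<^bsub>Q\<^esub>" by (auto simp: kernel_def)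
    then obtain g where "g \<in> carrier G" "x = \<pi> g" using \<pi>_onto by blast
    with x show "x \<in> derived G' P'" using \<psi>\<pi> q_one D' by auto
  next
    fix x assume "x \<in> derived G' P'"
    then obtain d where "d \<in> derived G P" "x = \<pi> d" using D' by auto
    then show "x \<in> kernel G' Q \<psi>"
      using D.subset \<psi>\<pi>[of d] q_one[of d] by (auto simp: kernel_def)
  qed
  then show ?thesis using \<psi>.FactGroup_iso[OF \<psi>_onto] by (simp add: Q_def)
qed


section \<open>The pure subgroups of the groups under consideration\<close>

lemma gens_closed: "1 \<le> i \<Longrightarrow> i < n \<Longrightarrow> Sigma i \<in> gens n" "1 \<le> i \<Longrightarrow> i < n \<Longrightarrow> Rho i \<in> gens n"
  by (auto simp: gens_def)

lemma VT_rels_words: "(u, v) \<in> VT_rels n \<Longrightarrow> u \<in> words (gens n) \<and> v \<in> words (gens n)"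
  unfolding VT_rels_def by (auto simp: gens_def)

lemma virtual_twin_presented_group:
  assumes "VT_rels n \<subseteq> R"
  shows "virtual_twin (presented_group (gens n) R) n
    (\<lambda>i. gen_class (gens n) R (Rho i)) (\<lambda>i. gen_class (gens n) R (Sigma i))"
proof -
  let ?G = "presented_group (gens n) R"
  let ?r = "\<lambda>i. gen_class (gens n) R (Rho i)" and ?s = "\<lambda>i. gen_class (gens n) R (Sigma i)"
  have eq: "word_cong (gens n) R `` {u} = word_cong (gens n) R `` {v}" if "(u, v) \<in> VT_rels n" for u v
    using that assms VT_rels_words by (intro rel_class_eq) auto
  interpret group "presented_group (gens n) R" by (rule group_presented_group)
  note [simp] = mult_class one_class gens_closed class_in_carrier
  show ?thesis
  proof
    fix i :: nat assume i: "1 \<le> i" "i < n"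
    have "([\<rho> i, \<rho> i], []) \<in> VT_rels n" "([\<sigma> i, \<sigma> i], []) \<in> VT_rels n"
      using i by (auto simp: VT_rels_def)
    from this[THEN eq] i
    show "?r i \<otimes>\<^bsub>?G\<^esub> ?r i = \<one>\<^bsub>?G\<^esub>" "?s i \<otimes>\<^bsub>?G\<^esub> ?s i = \<one>\<^bsub>?G\<^esub>"
        "?r i \<in> carrier ?G" "?s i \<in> carrier ?G"
      by simp_all
  next
    fix i j :: nat assume i: "1 \<le> i" "i + 2 \<le> j" "j < n"
    have "([\<rho> i, \<rho> j], [\<rho> j, \<rho> i]) \<in> VT_rels n" "([\<sigma> i, \<sigma> j], [\<sigma> j, \<sigma> i]) \<in> VT_rels n"
      using i by (auto simp: VT_rels_def)
    from this[THEN eq] i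
    show "?r i \<otimes>\<^bsub>?G\<^esub> ?r j = ?r j \<otimes>\<^bsub>?G\<^esub> ?r i" "?s i \<otimes>\<^bsub>?G\<^esub> ?s j = ?s j \<otimes>\<^bsub>?G\<^esub> ?s i"
      by simp_all
  next
    fix i j :: nat assume i: "1 \<le> i" "i < n" "1 \<le> j" "j < n" "i + 2 \<le> j \<or> j + 2 \<le> i"
    have "([\<rho> i, \<sigma> j], [\<sigma> j, \<rho> i]) \<in> VT_rels n"
      using i by (auto simp: VT_rels_def)
    from eq[OF this] i show "?r i \<otimes>\<^bsub>?G\<^esub> ?s j = ?s j \<otimes>\<^bsub>?G\<^esub> ?r i" by simp
  next
    fix i :: nat assume i: "1 \<le> i" "Suc i < n"
    have "([\<rho> i, \<rho> (i + 1), \<rho> i], [\<rho> (i + 1), \<rho> i, \<rho> (i + 1)]) \<in> VT_rels n"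
        "([\<rho> i, \<rho> (i + 1), \<sigma> i], [\<sigma> (i + 1), \<rho> i, \<rho> (i + 1)]) \<in> VT_rels n"
      using i unfolding VT_rels_def by auto
    from this[THEN eq] i
    show "?r i \<otimes>\<^bsub>?G\<^esub> ?r (Suc i) \<otimes>\<^bsub>?G\<^esub> ?r i = ?r (Suc i) \<otimes>\<^bsub>?G\<^esub> ?r i \<otimes>\<^bsub>?G\<^esub> ?r (Suc i)"
        "?r i \<otimes>\<^bsub>?G\<^esub> ?r (Suc i) \<otimes>\<^bsub>?G\<^esub> ?s i = ?s (Suc i) \<otimes>\<^bsub>?G\<^esub> ?r i \<otimes>\<^bsub>?G\<^esub> ?r (Suc i)"
      by simp_all
  qed
qed

lemma word_value_FWB_rels:
  assumes "(u, v) \<in> FWB_rels n"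
  shows "word_value (sym_group n) gen_perm u = word_value (sym_group n) gen_perm v"
proof (cases "(u, v) \<in> FVB_rels n")
  case False
  with assms show ?thesis
    unfolding FWB_rels_def by (auto simp: sym_group_mult sym_group_one transpose_braid)
qed (rule word_value_FVB_rels)

context
  fixes n :: nat and R :: "(gen word \<times> gen word) set"
  assumes R: "R \<subseteq> FWB_rels n"
begin

lemma perm_hom_class:
  assumes "w \<in> words (gens n)"
  shows "perm_hom n (word_cong (gens n) R `` {w}) = word_value (sym_group n) gen_perm w"
  unfolding perm_hom_def using R assms
  by (intro induced_hom_class[OF sym_group_is_group gen_perm_closed] word_value_FWB_rels) auto

lemma perm_hom_presented: "perm_hom n \<in> hom (presented_group (gens n) R) (sym_group n)"
  unfolding perm_hom_def using R
  by (intro induced_hom_in_hom[OF sym_group_is_group gen_perm_closed] word_value_FWB_rels) auto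

lemma class_in_kernel_iff:
  assumes "w \<in> words (gens n)"
  shows "word_cong (gens n) R `` {w} \<in> kernel (presented_group (gens n) R) (sym_group n) (perm_hom n)
    \<longleftrightarrow> word_value (sym_group n) gen_perm w = id"
  using assms by (simp add: kernel_def perm_hom_class class_in_carrier sym_group_one)

end

lemma FWB_kernel_commutative:
  assumes "2 \<le> n"
    and "x \<in> kernel (FWB n) (sym_group n) (perm_hom n)" "y \<in> kernel (FWB n) (sym_group n) (perm_hom n)"
  shows "x \<otimes>\<^bsub>FWB n\<^esub> y = y \<otimes>\<^bsub>FWB n\<^esub> x"
proof -
  let ?r = "\<lambda>i. gen_class (gens n) (FWB_rels n) (Rho i)"
  let ?s = "\<lambda>i. gen_class (gens n) (FWB_rels n) (Sigma i)"
  have sub: "VT_rels n \<subseteq> FWB_rels n" by (auto simp: FWB_rels_def FVB_rels_def)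
  interpret virtual_twin "FWB n" n ?r ?s
    unfolding FWB_def by (rule virtual_twin_presented_group[OF sub])
  have perm: "perm_hom n (gen_class (gens n) (FWB_rels n) x) = gen_perm x" if "x \<in> gens n" for x
    using that by (simp add: perm_hom_class sym_group_mult sym_group_one)
  have gens: "gens n = Rho ` {1..<n} \<union> Sigma ` {1..<n}"
    by (auto simp: gens_def)
  interpret flat_welded "FWB n" n ?r ?s "perm_hom n"
  proof
    show "perm_hom n \<in> hom (FWB n) (sym_group n)"
      unfolding FWB_def by (rule perm_hom_presented) simp
    show "carrier (FWB n) = generate (FWB n) (?r ` {1..<n} \<union> ?s ` {1..<n})"
      using presented_group_generated[of "gens n" "FWB_rels n"]
      by (simp add: FWB_def gens image_Un image_image)
  next
    fix i :: nat assume i: "1 \<le> i" "Suc i < n"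
    have "([\<rho> i, \<sigma> (i + 1), \<sigma> i], [\<sigma> (i + 1), \<sigma> i, \<rho> (i + 1)]) \<in> FWB_rels n"
      using i by (auto simp: FWB_rels_def)
    from rel_class_eq[OF this, of "gens n"] i
    show "?r i \<otimes>\<^bsub>FWB n\<^esub> ?s (Suc i) \<otimes>\<^bsub>FWB n\<^esub> ?s i = ?s (Suc i) \<otimes>\<^bsub>FWB n\<^esub> ?s i \<otimes>\<^bsub>FWB n\<^esub> ?r (Suc i)"
      by (simp add: FWB_def mult_class gens_closed)
  qed (use assms perm gens_closed in auto)
  show ?thesis using kernel_commutative assms by blast
qed

lemma PVT_normal: "PVT n \<lhd> VT n"
  unfolding PVT_def
  by (intro group_hom.normal_kernel)
    (simp add: group_hom_def group_hom_axioms_def group_VT sym_group_is_group perm_hom_VT)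

text \<open>
  The elements \<open>a i\<close> and \<open>b i\<close> are pure, so they commute modulo the derived subgroup, and the two sides
  of each additional relation differ only in the order of such factors.
\<close>

lemma FWB_rels_mod_derived_PVT:
  assumes "(u, v) \<in> FWB_rels n" "u \<in> words (gens n)" "v \<in> words (gens n)"
  shows "derived (VT n) (PVT n) #>\<^bsub>VT n\<^esub> word_cong (gens n) (VT_rels n) `` {u} =
    derived (VT n) (PVT n) #>\<^bsub>VT n\<^esub> word_cong (gens n) (VT_rels n) `` {v}"
proof -
  let ?r = "\<lambda>i. gen_class (gens n) (VT_rels n) (Rho i)"
  let ?s = "\<lambda>i. gen_class (gens n) (VT_rels n) (Sigma i)"
  interpret virtual_twin "VT n" n ?r ?s
    unfolding VT_def by (rule virtual_twin_presented_group) simp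
  interpret P: normal "PVT n" "VT n" by (rule PVT_normal)
  interpret D: normal "derived (VT n) (PVT n)" "VT n" by (rule derived_is_normal[OF PVT_normal])
  let ?q = "\<lambda>g. derived (VT n) (PVT n) #>\<^bsub>VT n\<^esub> g"
  have a: "a i \<in> PVT n" if i: "1 \<le> i" "i < n" for i
  proof -
    have "a i = word_cong (gens n) (VT_rels n) `` {[\<sigma> i, \<rho> i]}"
      using i unfolding a_def by (simp add: VT_def mult_class gens_closed)
    moreover have "word_value (sym_group n) gen_perm [\<sigma> i, \<rho> i] = id"
      by (simp add: sym_group_mult sym_group_one)
    ultimately show ?thesis
      using i class_in_kernel_iff[of "VT_rels n" n "[\<sigma> i, \<rho> i]"]
      by (auto simp: PVT_def VT_def FWB_rels_def FVB_rels_def gens_closed)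
  qed
  have b: "b i \<in> PVT n" if i: "1 \<le> i" "Suc i < n" for i
    using P.inv_op_closed2[of "?r i" "a (Suc i)"] a[of "Suc i"] i by (simp add: b_def inv_r r_closed)
  have swap: "?q (x \<otimes>\<^bsub>VT n\<^esub> y \<otimes>\<^bsub>VT n\<^esub> z) = ?q (y \<otimes>\<^bsub>VT n\<^esub> x \<otimes>\<^bsub>VT n\<^esub> z)"
    if "x \<in> PVT n" "y \<in> PVT n" "z \<in> carrier (VT n)" for x y z
  proof -
    have c: "x \<in> carrier (VT n)" "y \<in> carrier (VT n)" using that P.subset by auto
    have "?q (x \<otimes>\<^bsub>VT n\<^esub> y \<otimes>\<^bsub>VT n\<^esub> z) = ?q (x \<otimes>\<^bsub>VT n\<^esub> y) <#>\<^bsub>VT n\<^esub> ?q z"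
      using c that by (simp add: D.rcos_sum)
    also have "\<dots> = ?q (y \<otimes>\<^bsub>VT n\<^esub> x) <#>\<^bsub>VT n\<^esub> ?q z"
      by (simp only: derived_coset_commute[OF PVT_normal that(1,2)])
    also have "\<dots> = ?q (y \<otimes>\<^bsub>VT n\<^esub> x \<otimes>\<^bsub>VT n\<^esub> z)"
      using c that by (simp add: D.rcos_sum)
    finally show ?thesis .
  qed
  consider "(u, v) \<in> VT_rels n"
    | i where "1 \<le> i" "Suc i < n" "u = [\<sigma> i, \<sigma> (Suc i), \<sigma> i]" "v = [\<sigma> (Suc i), \<sigma> i, \<sigma> (Suc i)]"
    | i where "1 \<le> i" "Suc i < n" "u = [\<rho> i, \<sigma> (Suc i), \<sigma> i]" "v = [\<sigma> (Suc i), \<sigma> i, \<rho> (Suc i)]"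
    using assms(1) unfolding FWB_rels_def FVB_rels_def by auto
  then show ?thesis
  proof cases
    case 1
    then show ?thesis using assms rel_class_eq by metis
  next
    case (2 i)
    define d where "d = ?r i \<otimes>\<^bsub>VT n\<^esub> ?r (Suc i) \<otimes>\<^bsub>VT n\<^esub> ?r i"
    have P: "a i \<in> PVT n" "b i \<in> PVT n" "a (Suc i) \<in> PVT n" using 2 a b by auto
    then have c: "a i \<in> carrier (VT n)" "b i \<in> carrier (VT n)" "a (Suc i) \<in> carrier (VT n)"
        "d \<in> carrier (VT n)"
      using 2 P.subset r_closed by (auto simp: d_def)
    \<comment> \<open>Three exchanges of pure factors reverse the order of \<open>a i\<close>, \<open>b i\<close>, \<open>a (i + 1)\<close>.\<close>
    have "?q (a i \<otimes>\<^bsub>VT n\<^esub> b i \<otimes>\<^bsub>VT n\<^esub> a (Suc i) \<otimes>\<^bsub>VT n\<^esub> d)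
        = ?q (a (Suc i) \<otimes>\<^bsub>VT n\<^esub> (a i \<otimes>\<^bsub>VT n\<^esub> b i) \<otimes>\<^bsub>VT n\<^esub> d)"
      using P c by (intro swap) auto
    also have "\<dots> = ?q (a (Suc i) \<otimes>\<^bsub>VT n\<^esub> a i \<otimes>\<^bsub>VT n\<^esub> (b i \<otimes>\<^bsub>VT n\<^esub> d))"
      using c by (simp add: m_assoc)
    also have "\<dots> = ?q (a i \<otimes>\<^bsub>VT n\<^esub> a (Suc i) \<otimes>\<^bsub>VT n\<^esub> (b i \<otimes>\<^bsub>VT n\<^esub> d))"
      using P c by (intro swap) auto
    also have "\<dots> = ?q (a i \<otimes>\<^bsub>VT n\<^esub> (a (Suc i) \<otimes>\<^bsub>VT n\<^esub> b i) \<otimes>\<^bsub>VT n\<^esub> d)"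
      using c by (simp add: m_assoc)
    also have "\<dots> = ?q (a (Suc i) \<otimes>\<^bsub>VT n\<^esub> b i \<otimes>\<^bsub>VT n\<^esub> a i \<otimes>\<^bsub>VT n\<^esub> d)"
      using P c by (intro swap) auto
    finally have "?q (?s i \<otimes>\<^bsub>VT n\<^esub> ?s (Suc i) \<otimes>\<^bsub>VT n\<^esub> ?s i)
        = ?q (?s (Suc i) \<otimes>\<^bsub>VT n\<^esub> ?s i \<otimes>\<^bsub>VT n\<^esub> ?s (Suc i))"
      unfolding sss_eq[OF 2(1,2)] sss_eq'[OF 2(1,2)] d_def .
    then show ?thesis using 2 by (simp add: VT_def mult_class gens_closed)
  next
    case (3 i)
    have "?q (b i \<otimes>\<^bsub>VT n\<^esub> a (Suc i) \<otimes>\<^bsub>VT n\<^esub> (?r i \<otimes>\<^bsub>VT n\<^esub> ?r (Suc i) \<otimes>\<^bsub>VT n\<^esub> ?r i))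
        = ?q (a (Suc i) \<otimes>\<^bsub>VT n\<^esub> b i \<otimes>\<^bsub>VT n\<^esub> (?r i \<otimes>\<^bsub>VT n\<^esub> ?r (Suc i) \<otimes>\<^bsub>VT n\<^esub> ?r i))"
      using 3 a b r_closed by (intro swap) auto
    then have "?q (?r i \<otimes>\<^bsub>VT n\<^esub> ?s (Suc i) \<otimes>\<^bsub>VT n\<^esub> ?s i)
        = ?q (?s (Suc i) \<otimes>\<^bsub>VT n\<^esub> ?s i \<otimes>\<^bsub>VT n\<^esub> ?r (Suc i))"
      unfolding rss_eq[OF 3(1,2)] ssr_eq[OF 3(1,2)] .
    then show ?thesis using 3 by (simp add: VT_def mult_class gens_closed)
  qed
qed

text \<open>
  All groups between \<open>VT\<close> and \<open>FWB\<close> have the same words of trivial permutation, which is what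
  identifies their pure subgroups with each other.
\<close>

lemma presented_group_Mod_derived_kernel_iso:
  assumes "VT_rels n \<subseteq> R" "R \<subseteq> FWB_rels n"
  defines "G \<equiv> presented_group (gens n) R"
  shows "G Mod derived G (kernel G (sym_group n) (perm_hom n)) \<cong> VT n Mod derived (VT n) (PVT n)"
  unfolding G_def VT_def
proof (rule presented_group_Mod_derived_iso)
  have VT: "VT_rels n \<subseteq> FWB_rels n" using assms by blast
  show "word_cong (gens n) (VT_rels n) `` {w} \<in> PVT n \<longleftrightarrow>
      word_cong (gens n) R `` {w} \<in> kernel (presented_group (gens n) R) (sym_group n) (perm_hom n)"
    if "w \<in> words (gens n)" for w
    using that class_in_kernel_iff[OF VT that] class_in_kernel_iff[OF assms(2) that]
    by (simp add: PVT_def VT_def)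
qed (use assms PVT_normal FWB_rels_mod_derived_PVT in \<open>auto simp: VT_def kernel_def\<close>)

theorem theorem5p2:
  fixes n :: nat
  assumes "n \<ge> 2"
  shows "FWB n \<cong> VT n Mod derived (VT n) (PVT n)
    \<and> FVB n Mod derived (FVB n) (FVP n) \<cong> VT n Mod derived (VT n) (PVT n)"
proof
  let ?K = "kernel (FWB n) (sym_group n) (perm_hom n)"
  interpret FWB: group "FWB n" by (rule group_FWB)
  have "derived (FWB n) ?K = {\<one>\<^bsub>FWB n\<^esub>}"
    using assms by (intro FWB.derived_trivial FWB_kernel_commutative) (auto simp: kernel_def)
  moreover have "FWB n Mod derived (FWB n) ?K \<cong> VT n Mod derived (VT n) (PVT n)"
    unfolding FWB_def by (rule presented_group_Mod_derived_kernel_iso) (auto simp: FWB_rels_def FVB_rels_def)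
  ultimately have "FWB n Mod {\<one>\<^bsub>FWB n\<^esub>} \<cong> VT n Mod derived (VT n) (PVT n)" by simp
  moreover have "FWB n \<cong> FWB n Mod {\<one>\<^bsub>FWB n\<^esub>}"
    using FWB.trivial_factor_iso group.iso_sym[OF normal.factorgroup_is_group] FWB.one_is_normal
    by (metis is_isoI)
  ultimately show "FWB n \<cong> VT n Mod derived (VT n) (PVT n)" by (rule iso_trans[rotated])
next
  show "FVB n Mod derived (FVB n) (FVP n) \<cong> VT n Mod derived (VT n) (PVT n)"
    unfolding FVP_def FVB_def
    by (rule presented_group_Mod_derived_kernel_iso) (auto simp: FWB_rels_def FVB_rels_def)
qed

end
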